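(* Let $X=X(A,P)$ be a non-toric rational projective $\mathbb K^*$-surface with vertical $P$-roots at $D^+$ and let $0\le i_0,i_1\le r$ be distinct. Then $U(X)$ is generated by the root groups arising from those vertical $P$-roots $u$ at $D^+$ that satisfy $0\le\langle u,v_{i1}\rangle<l_{i1}$ for all $0\le i\le r$ different from $i_0,i_1$.
   Context: $\mathbb K$ is an algebraically closed field of characteristic zero; $\mathbb K$ also denotes its additive group. A $\mathbb K^*$-surface is a normal irreducible surface with an effective morphical $\mathbb K^*$-action. The surface $X(A,P)$. Let $r\ge1$, $n_0,\dots,n_r\ge1$; $A=[a_0,\dots,a_r]$ a $2\times(r+1)$-matrix over $\mathbb K$ with pairwise linearly independent columns; $e_1,\dots,e_{r+1}$ the canonical basis of $\mathbb Z^{r+1}$ and $e_0:=-e_1-\dots-e_r$. $P$ is an integral matrix with columns $v_{ij}=l_{ij}e_i+d_{ij}e_{r+1}$ ($0\le i\le r$, $1\le j\le n_i$), $l_{ij}\ge1$, $\gcd(l_{ij},d_{ij})=1$, and, each optionally, $v^+=e_{r+1}$, $v^-=-e_{r+1}$; the columns are pairwise distinct and generate $\mathbb Q^{r+1}$ as a cone. With slopes $m_{ij}=d_{ij}/l_{ij}$, $P$ is slope ordered: $m_{i1}>\dots>m_{in_i}$. $P$ is assumed irredundant: $l_{i1}n_i\ge2$ for all $i$. Let $\Sigma$ be the fan with maximal cones $\mathrm{cone}(v_{ij},v_{ij+1})$ ($1\le j<n_i$); $\mathrm{cone}(v^+,v_{i1})$ ($0\le i\le r$) if $v^+$ is present and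 $\sigma^+=\mathrm{cone}(v_{01},\dots,v_{r1})$ otherwise; $\mathrm{cone}(v_{in_i},v^-)$ if $v^-$ is present and $\sigma^-=\mathrm{cone}(v_{0n_0},\dots,v_{rn_r})$ otherwise. Let $Z$ be its toric variety, with Cox coordinates $T_{ij},S^\pm$ and Cox quotient $p\colon\hat Z\to Z$, $\hat Z\subseteq\bar Z=\mathbb K^{\#\text{columns}}$, by $H=\mathrm{Spec}\,\mathbb K[\mathrm{Cl}(Z)]$. Then $X=X(A,P)=p(\bar X\cap\hat Z)\subseteq Z$, where $\bar X\subseteq\bar Z$ is the zero set of all $g_{ijk}=\det\begin{bmatrix}T_{i}^{l_{i}}&T_{j}^{l_{j}}&T_{k}^{l_{k}}\\ a_{i}&a_{j}&a_{k}\end{bmatrix}$, $0\le i<j<k\le r$, $T_i^{l_i}=\prod_jT_{ij}^{l_{ij}}$. $\mathbb K^*$ acts on $X$ via $t\cdot z=(z_1,\dots,z_r,tz_{r+1})$ on the acting torus of $Z$. The Cox ring of $X$ is $R(A,P)=\mathbb K[T_{ij},S^\pm]/\langle g_{ijk}\rangle$. $X$ is toric iff $r=1$. $D^\pm\subseteq X$ are the curves (of fixed points) cut out by the toric divisors of $v^\pm$. The source of $X$ is $D^+$ if $v^+$ is present, and otherwise the elliptic fixed point $x^+$ corresponding to $\sigma^+$; the sink is $D^-$ resp. the elliptic fixed point $x^-$ corresponding to $\sigma^-$. $P$-roots. A horizontal $P$-root at $(x^+,i_0,i_1)$ ($x^+$ an elliptic fixed point) is $u\in\mathbb Z^r\times\mathbb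 Z_{<0}$ with: $\langle u,v_{i_11}\rangle=-1$; $\langle u,v_{i1}\rangle=0$ and $l_{i1}=1$ for $i\ne i_0,i_1$; $\langle u,v_{i_01}\rangle\ge0$; $\langle u,v_{i_12}\rangle\ge0$ if $n_{i_1}>1$; $\langle u,v_{i2}\rangle\ge l_{i2}$ for $i\ne i_0,i_1$ (with $n_i>1$). A horizontal $P$-root at $(x^-,i_0,i_1)$ is $u\in\mathbb Z^r\times\mathbb Z_{>0}$ with: $\langle u,v_{i_1n_{i_1}}\rangle=-1$; $\langle u,v_{in_i}\rangle=0$ and $l_{in_i}=1$ for $i\ne i_0,i_1$; $\langle u,v_{i_0n_{i_0}}\rangle\ge0$; $\langle u,v_{i_1n_{i_1}-1}\rangle\ge0$ if $n_{i_1}>1$; $\langle u,v_{in_i-1}\rangle\ge l_{in_i-1}$ for $i\ne i_0,i_1$ (with $n_i>1$). A vertical $P$-root at a curve $D^+$ is $u\in\mathbb Z^r\times\mathbb Z_{<0}$ with $\langle u,v^+\rangle=-1$, $\langle u,v_{i1}\rangle\ge0$ for all $i$; a vertical $P$-root at $D^-$ is $u\in\mathbb Z^r\times\mathbb Z_{>0}$ with $\langle u,v^-\rangle=-1$, $\langle u,v_{in_i}\rangle\ge0$ for all $i$. Root groups. Put $h^u=\prod T_{ij}^{\langle u,v_{ij}\rangle}\prod (S^\pm)^{\langle u,v^\pm\rangle}$. A vertical $P$-root $u$ at $D^\pm$ gives the derivation $\delta$ of $\mathbb K[T_{ij},S^\pm]$ with $\delta(S^\pm)=h^uS^\pm$ for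 the variable of $D^\pm$, and $\delta=0$ on the other variables. A horizontal $P$-root $u$ at $(x^\pm,i_0,i_1)$ gives, with $c_i=1$ (case $x^+$) resp. $c_i=n_i$ (case $x^-$), $h^\zeta=T_{i_1c_{i_1}}^{-1}\prod_{i\ne i_0,i_1}\prod_{j\ne c_i}T_{ij}^{l_{ij}}$ and $\beta$ the unique vector in the row space of $A$ with $\beta_{i_0}=0$, $\beta_{i_1}=1$, the derivation with $\delta(T_{ic_i})=\beta_i\frac{h^u}{h^\zeta}\prod_{k\ne i,i_0}\frac{\partial T_k^{l_k}}{\partial T_{kc_k}}$ and $\delta=0$ on the other variables. In both cases $\delta$ induces a homogeneous degree zero locally nilpotent derivation on $R(A,P)$, and the $\mathbb K$-action on $\bar X$ with comorphisms $\exp(s\delta)$ descends to a homomorphism $\lambda_u\colon\mathbb K\to\mathrm{Aut}(X)$, the root group arising from $u$. $U(X)\subseteq\mathrm{Aut}(X)$ is the subgroup generated by all root groups of $X$ (those of all horizontal and vertical $P$-roots). *)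

theory Defs
  imports
    "HOL-Analysis.Determinants"
    "HOL-Algebra.Bij"
    "HOL-Algebra.Generated_Groups"
    "HOL-Library.Poly_Mapping"
    "HOL-Computational_Algebra.Polynomial"
begin

section \<open>Polynomials in several variables\<close>

type_synonym ('v, 'k) mpoly = "('v \<Rightarrow>\<^sub>0 nat) \<Rightarrow>\<^sub>0 'k"

definition Const :: "'k::comm_ring_1 \<Rightarrow> ('v, 'k) mpoly" where
  "Const a = Poly_Mapping.single 0 a"

definition Var :: "'v \<Rightarrow> ('v, 'k::comm_ring_1) mpoly" where
  "Var v = Poly_Mapping.single (Poly_Mapping.single v 1) 1"

definition peval :: "('v \<Rightarrow> 'k) \<Rightarrow> ('v, 'k::comm_ring_1) mpoly \<Rightarrow> 'k" where
  "peval x f = (\<Sum>m\<in>Poly_Mapping.keys f.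
     Poly_Mapping.lookup f m * (\<Prod>v\<in>Poly_Mapping.keys m. x v ^ Poly_Mapping.lookup m v))"

definition pdiff :: "'v \<Rightarrow> ('v, 'k::comm_ring_1) mpoly \<Rightarrow> ('v, 'k) mpoly" where
  "pdiff v f = (\<Sum>m\<in>Poly_Mapping.keys f.
     Poly_Mapping.single (m - Poly_Mapping.single v 1)
       (of_nat (Poly_Mapping.lookup m v) * Poly_Mapping.lookup f m))"

text \<open>The \<open>K\<close>-derivation sending the variable \<open>v \<in> I\<close> to \<open>q v\<close> and all other variables to \<open>0\<close>.\<close>

definition deriv_of :: "'v set \<Rightarrow> ('v \<Rightarrow> ('v, 'k::comm_ring_1) mpoly) \<Rightarrow> ('v, 'k) mpoly \<Rightarrow> ('v, 'k) mpoly" where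
  "deriv_of I q f = (\<Sum>v\<in>I. q v * pdiff v f)"

text \<open>\<open>exp (s \<delta>)\<close> for a locally nilpotent \<open>\<delta>\<close>; local nilpotency is what makes the index set finite.\<close>

definition exp_deriv ::
  "(('v, 'k) mpoly \<Rightarrow> ('v, 'k) mpoly) \<Rightarrow> 'k::field_char_0 \<Rightarrow> ('v, 'k) mpoly \<Rightarrow> ('v, 'k) mpoly" where
  "exp_deriv \<delta> s f = (\<Sum>k | (\<delta> ^^ k) f \<noteq> 0. Const (s ^ k / fact k) * (\<delta> ^^ k) f)"

section \<open>Varieties as spaces with functions\<close>

text \<open>
  Classical points of a variety, its Zariski open sets, and the regular functions on each of them
  (\<open>regular U f\<close> depends on the values of \<open>f\<close> on \<open>U\<close> only).
\<close>

record ('p, 'k) fspace =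
  points :: "'p set"
  is_open :: "'p set \<Rightarrow> bool"
  regular :: "'p set \<Rightarrow> ('p \<Rightarrow> 'k) \<Rightarrow> bool"

definition fmorphism :: "('p, 'k) fspace \<Rightarrow> ('q, 'k) fspace \<Rightarrow> ('p \<Rightarrow> 'q) \<Rightarrow> bool" where
  "fmorphism X Y \<phi> \<longleftrightarrow>
     \<phi> ` points X \<subseteq> points Y \<and>
     (\<forall>V. is_open Y V \<longrightarrow>
        is_open X {x \<in> points X. \<phi> x \<in> V} \<and>
        (\<forall>f. regular Y V f \<longrightarrow> regular X {x \<in> points X. \<phi> x \<in> V} (f \<circ> \<phi>)))"

definition fisomorphism :: "('p, 'k) fspace \<Rightarrow> ('q, 'k) fspace \<Rightarrow> ('p \<Rightarrow> 'q) \<Rightarrow> bool" where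
  "fisomorphism X Y \<phi> \<longleftrightarrow>
     bij_betw \<phi> (points X) (points Y) \<and>
     fmorphism X Y \<phi> \<and> fmorphism Y X (inv_into (points X) \<phi>)"

definition Aut :: "('p, 'k) fspace \<Rightarrow> ('p \<Rightarrow> 'p) monoid" where
  "Aut X = BijGroup (points X)
     \<lparr>carrier := {\<phi> \<in> extensional (points X). fisomorphism X X \<phi>}\<rparr>"

definition open_subspace :: "('p, 'k) fspace \<Rightarrow> 'p set \<Rightarrow> ('p, 'k) fspace" where
  "open_subspace X W =
     \<lparr>points = W,
      is_open = (\<lambda>U. U \<subseteq> W \<and> is_open X U),
      regular = (\<lambda>U f. U \<subseteq> W \<and> regular X U f)\<rparr>"

definition open_embedding :: "('p, 'k) fspace \<Rightarrow> ('q, 'k) fspace \<Rightarrow> ('p \<Rightarrow> 'q) \<Rightarrow> bool" where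
  "open_embedding X Y \<phi> \<longleftrightarrow>
     is_open Y (\<phi> ` points X) \<and> fisomorphism X (open_subspace Y (\<phi> ` points X)) \<phi>"

definition affine_space :: "'v set \<Rightarrow> ('v \<Rightarrow> 'k) set" where
  "affine_space I = I \<rightarrow>\<^sub>E UNIV"

definition zariski_open :: "('v \<Rightarrow> 'k::field) set \<Rightarrow> ('v \<Rightarrow> 'k) set \<Rightarrow> bool" where
  "zariski_open Y U \<longleftrightarrow> (\<exists>F. U = {x \<in> Y. \<exists>g\<in>F. peval x g \<noteq> 0})"

text \<open>
  The structure of a quasi-affine variety on a locally closed subset \<open>Y\<close> of an affine space:
  regular functions are locally fractions of polynomials.
\<close>

definition quasi_affine :: "('v \<Rightarrow> 'k::field) set \<Rightarrow> ('v \<Rightarrow> 'k, 'k) fspace" where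
  "quasi_affine Y =
     \<lparr>points = Y,
      is_open = zariski_open Y,
      regular = (\<lambda>U f. zariski_open Y U \<and>
        (\<forall>x\<in>U. \<exists>a b. peval x b \<noteq> 0 \<and>
           (\<forall>y\<in>U. peval y b \<noteq> 0 \<longrightarrow> f y = peval y a / peval y b)))\<rparr>"

text \<open>The quotient structure on the image of a map \<open>\<pi>\<close>: \<open>O(U) = O(\<pi>\<inverse>(U))\<close>, restricted to
  functions that are constant on fibres.\<close>

definition quotient_fspace :: "('p, 'k) fspace \<Rightarrow> ('p \<Rightarrow> 'q) \<Rightarrow> ('q, 'k) fspace" where
  "quotient_fspace X \<pi> =
     \<lparr>points = \<pi> ` points X,
      is_open = (\<lambda>U. U \<subseteq> \<pi> ` points X \<and> is_open X {x \<in> points X. \<pi> x \<in> U}),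
      regular = (\<lambda>U f. U \<subseteq> \<pi> ` points X \<and> is_open X {x \<in> points X. \<pi> x \<in> U} \<and>
         regular X {x \<in> points X. \<pi> x \<in> U} (f \<circ> \<pi>))\<rparr>"

text \<open>
  The product of varieties: functions \<open>\<Sum> f\<^sub>i(x) g\<^sub>i(y)\<close> on boxes \<open>U \<times> V\<close> yield a basis of
  open sets and, locally as fractions, the regular functions.
\<close>

definition tensor_functions ::
  "('p, 'k::field) fspace \<Rightarrow> ('q, 'k) fspace \<Rightarrow> 'p set \<Rightarrow> 'q set \<Rightarrow> ('p \<times> 'q \<Rightarrow> 'k) set" where
  "tensor_functions X Y U V =
     {h. \<exists>(m::nat) f g. (\<forall>i<m. regular X U (f i) \<and> regular Y V (g i)) \<and>
           h = (\<lambda>(x, y). \<Sum>i<m. f i x * g i y)}"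

definition product_open ::
  "('p, 'k::field) fspace \<Rightarrow> ('q, 'k) fspace \<Rightarrow> ('p \<times> 'q) set \<Rightarrow> bool" where
  "product_open X Y W \<longleftrightarrow>
     W \<subseteq> points X \<times> points Y \<and>
     (\<forall>w\<in>W. \<exists>U V. is_open X U \<and> is_open Y V \<and> w \<in> U \<times> V \<and>
        (\<exists>b\<in>tensor_functions X Y U V. b w \<noteq> 0 \<and> {z \<in> U \<times> V. b z \<noteq> 0} \<subseteq> W))"

definition product_fspace ::
  "('p, 'k::field) fspace \<Rightarrow> ('q, 'k) fspace \<Rightarrow> ('p \<times> 'q, 'k) fspace" where
  "product_fspace X Y =
     \<lparr>points = points X \<times> points Y,
      is_open = product_open X Y,
      regular = (\<lambda>W h. product_open X Y W \<and>
        (\<forall>w\<in>W. \<exists>U V. is_open X U \<and> is_open Y V \<and> w \<in> U \<times> V \<and>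
           (\<exists>a\<in>tensor_functions X Y U V. \<exists>b\<in>tensor_functions X Y U V. b w \<noteq> 0 \<and>
              (\<forall>z\<in>W \<inter> U \<times> V. b z \<noteq> 0 \<longrightarrow> h z = a z / b z))))\<rparr>"

definition torus :: "nat \<Rightarrow> (nat \<Rightarrow> 'k::field, 'k) fspace" where
  "torus N = quasi_affine ({..<N} \<rightarrow>\<^sub>E UNIV - {0})"

text \<open>
  A normal irreducible variety \<open>X\<close> is toric if a torus \<open>(K\<^sup>*)\<^sup>N\<close> acts morphically on it such that
  some orbit map is an open embedding. Normality and irreducibility are not part of the
  definition; they hold for all varieties \<open>X(A, P)\<close> considered here.
\<close>

definition toric :: "('p, 'k::field) fspace \<Rightarrow> bool" where
  "toric X \<longleftrightarrow>
     (\<exists>N (\<mu> :: (nat \<Rightarrow> 'k) \<Rightarrow> 'p \<Rightarrow> 'p). \<exists>x\<^sub>0\<in>points X.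
        fmorphism (product_fspace (torus N) X) X (\<lambda>(t, x). \<mu> t x) \<and>
        (\<forall>x\<in>points X. \<mu> (\<lambda>i\<in>{..<N}. 1) x = x) \<and>
        (\<forall>s\<in>points (torus N). \<forall>t\<in>points (torus N). \<forall>x\<in>points X.
           \<mu> (\<lambda>i\<in>{..<N}. s i * t i) x = \<mu> s (\<mu> t x)) \<and>
        open_embedding (torus N) X (\<lambda>t. \<mu> t x\<^sub>0))"

section \<open>The defining data \<open>(A, P)\<close>\<close>

text \<open>
  \<open>Plus\<close> and \<open>Minus\<close> stand for source and sink; \<open>poles\<close> records which of the columns
  \<open>v\<^sup>+\<close>, \<open>v\<^sup>-\<close> are present. \<open>Acol i\<close> is the column \<open>a\<^sub>i\<close> of \<open>A\<close>. The entries \<open>num\<close>, \<open>Acol\<close>, \<open>ell\<close>, \<open>dd\<close>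
  are only relevant for \<open>0 \<le> i \<le> r\<close>, \<open>1 \<le> j \<le> n\<^sub>i\<close>.
\<close>

datatype pole = Plus | Minus

datatype col = ColT nat nat | ColS pole

record 'k APdata =
  rr :: nat
  num :: "nat \<Rightarrow> nat"
  Acol :: "nat \<Rightarrow> 'k \<times> 'k"
  ell :: "nat \<Rightarrow> nat \<Rightarrow> nat"
  dd :: "nat \<Rightarrow> nat \<Rightarrow> int"
  poles :: "pole set"

definition pole_sign :: "pole \<Rightarrow> int" where
  "pole_sign s = (case s of Plus \<Rightarrow> 1 | Minus \<Rightarrow> - 1)"

text \<open>Vectors in \<open>\<int>\<^sup>r\<^sup>+\<^sup>1\<close> are functions supported on \<open>{1..r+1}\<close>.\<close>

definition lattice_vectors :: "'k APdata \<Rightarrow> (nat \<Rightarrow> int) set" where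
  "lattice_vectors D = {u. \<forall>k. k \<notin> {1..rr D + 1} \<longrightarrow> u k = 0}"

definition unit_vec :: "'k APdata \<Rightarrow> nat \<Rightarrow> nat \<Rightarrow> int" where
  "unit_vec D i k =
     (if i = 0 then (if k \<in> {1..rr D} then - 1 else 0) else (if k = i then 1 else 0))"

definition cols :: "'k APdata \<Rightarrow> col set" where
  "cols D = {ColT i j | i j. i \<le> rr D \<and> 1 \<le> j \<and> j \<le> num D i} \<union> ColS ` poles D"

fun col_vec :: "'k APdata \<Rightarrow> col \<Rightarrow> nat \<Rightarrow> int" where
  "col_vec D (ColT i j) k = int (ell D i j) * unit_vec D i k + dd D i j * unit_vec D (rr D + 1) k"
| "col_vec D (ColS s) k = pole_sign s * unit_vec D (rr D + 1) k"

definition pairing :: "'k APdata \<Rightarrow> (nat \<Rightarrow> int) \<Rightarrow> col \<Rightarrow> int" where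
  "pairing D u c = (\<Sum>k\<in>{1..rr D + 1}. u k * col_vec D c k)"

definition slope :: "'k APdata \<Rightarrow> nat \<Rightarrow> nat \<Rightarrow> rat" where
  "slope D i j = of_int (dd D i j) / of_nat (ell D i j)"

definition AP_data :: "'k::field APdata \<Rightarrow> bool" where
  "AP_data D \<longleftrightarrow>
     1 \<le> rr D \<and>
     (\<forall>i\<le>rr D. 1 \<le> num D i) \<and>
     (\<forall>i\<le>rr D. \<forall>j\<le>rr D. i \<noteq> j \<longrightarrow>
        (\<forall>x y. x * fst (Acol D i) + y * fst (Acol D j) = 0 \<and>
               x * snd (Acol D i) + y * snd (Acol D j) = 0 \<longrightarrow> x = 0 \<and> y = 0)) \<and>
     (\<forall>i\<le>rr D. \<forall>j\<in>{1..num D i}. 1 \<le> ell D i j \<and> gcd (int (ell D i j)) (dd D i j) = 1) \<and>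
     inj_on (col_vec D) (cols D) \<and>
     (\<forall>w :: nat \<Rightarrow> rat. \<exists>\<alpha>. (\<forall>c\<in>cols D. 0 \<le> \<alpha> c) \<and>
        (\<forall>k\<in>{1..rr D + 1}. w k = (\<Sum>c\<in>cols D. \<alpha> c * of_int (col_vec D c k)))) \<and>
     (\<forall>i\<le>rr D. \<forall>j j'. 1 \<le> j \<and> j < j' \<and> j' \<le> num D i \<longrightarrow> slope D i j > slope D i j') \<and>
     (\<forall>i\<le>rr D. ell D i 1 * num D i \<ge> 2)"

section \<open>The surface \<open>X(A, P)\<close>\<close>

text \<open>The column of arm \<open>i\<close> next to the given pole, and the one following it.\<close>

definition end_idx :: "'k APdata \<Rightarrow> pole \<Rightarrow> nat \<Rightarrow> nat" where
  "end_idx D s i = (case s of Plus \<Rightarrow> 1 | Minus \<Rightarrow> num D i)"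

definition next_idx :: "'k APdata \<Rightarrow> pole \<Rightarrow> nat \<Rightarrow> nat" where
  "next_idx D s i = (case s of Plus \<Rightarrow> 2 | Minus \<Rightarrow> num D i - 1)"

text \<open>
  Each maximal cone of \<open>\<Sigma>\<close> is encoded by the set of columns generating it. These are linearly
  independent (for \<open>\<sigma>\<^sup>+\<close> and \<open>\<sigma>\<^sup>-\<close> because all columns together generate the whole space as a cone)
  and hence the primitive ray generators, so \<open>Z_hat\<close> is the usual complement of the irrelevant locus.
\<close>

definition max_cones :: "'k APdata \<Rightarrow> col set set" where
  "max_cones D =
     {{ColT i j, ColT i (j + 1)} | i j. i \<le> rr D \<and> 1 \<le> j \<and> j < num D i} \<union>
     {{ColS s, ColT i (end_idx D s i)} | s i. s \<in> poles D \<and> i \<le> rr D} \<union>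
     {{ColT i (end_idx D s i) | i. i \<le> rr D} | s. s \<notin> poles D}"

definition Z_hat :: "'k::field APdata \<Rightarrow> (col \<Rightarrow> 'k) set" where
  "Z_hat D = {z \<in> affine_space (cols D). \<exists>\<sigma>\<in>max_cones D. \<forall>c\<in>cols D - \<sigma>. z c \<noteq> 0}"

text \<open>\<open>Cl(Z)\<close> is the cokernel of the transpose \<open>P\<^sup>*\<close>, so the points of \<open>H = Spec K[Cl(Z)]\<close> are the elements of
  the big torus of the affine space that are trivial, as characters, on the image of \<open>P\<^sup>*\<close>.\<close>

definition H_group :: "'k::field APdata \<Rightarrow> (col \<Rightarrow> 'k) set" where
  "H_group D = {h \<in> cols D \<rightarrow>\<^sub>E UNIV - {0}.
     \<forall>u\<in>lattice_vectors D. (\<Prod>c\<in>cols D. h c powi pairing D u c) = 1}"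

text \<open>Since \<open>\<Sigma>\<close> is simplicial, the fibres of the Cox quotient \<open>p\<close> are exactly the \<open>H\<close>-orbits.\<close>

definition cox_quotient :: "'k::field APdata \<Rightarrow> (col \<Rightarrow> 'k) \<Rightarrow> (col \<Rightarrow> 'k) set" where
  "cox_quotient D z = (\<lambda>h. \<lambda>c\<in>cols D. h c * z c) ` H_group D"

definition Tpow :: "'k::field APdata \<Rightarrow> nat \<Rightarrow> (col, 'k) mpoly" where
  "Tpow D i = (\<Prod>j\<in>{1..num D i}. Var (ColT i j) ^ ell D i j)"

definition trinomial :: "'k::field APdata \<Rightarrow> nat \<Rightarrow> nat \<Rightarrow> nat \<Rightarrow> (col, 'k) mpoly" where
  "trinomial D i j k =
     det (vector [vector [Tpow D i, Tpow D j, Tpow D k],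
                  vector [Const (fst (Acol D i)), Const (fst (Acol D j)), Const (fst (Acol D k))],
                  vector [Const (snd (Acol D i)), Const (snd (Acol D j)), Const (snd (Acol D k))]]
          :: (col, 'k) mpoly ^ 3 ^ 3)"

definition X_bar :: "'k::field APdata \<Rightarrow> (col \<Rightarrow> 'k) set" where
  "X_bar D = {z \<in> affine_space (cols D).
     \<forall>i j k. i < j \<and> j < k \<and> k \<le> rr D \<longrightarrow> peval z (trinomial D i j k) = 0}"

text \<open>The variety \<open>X(A, P) = p(X_bar \<inter> Z_hat)\<close>; its structure sheaf is the sheaf of \<open>H\<close>-invariants
  of that of \<open>X_bar \<inter> Z_hat\<close>.\<close>

definition X_surface :: "'k::field APdata \<Rightarrow> ((col \<Rightarrow> 'k) set, 'k) fspace" where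
  "X_surface D = quotient_fspace (quasi_affine (X_bar D \<inter> Z_hat D)) (cox_quotient D)"

section \<open>\<open>P\<close>-roots and root groups\<close>

definition vertical_root :: "'k APdata \<Rightarrow> pole \<Rightarrow> (nat \<Rightarrow> int) \<Rightarrow> bool" where
  "vertical_root D s u \<longleftrightarrow>
     s \<in> poles D \<and> u \<in> lattice_vectors D \<and>
     pole_sign s * u (rr D + 1) < 0 \<and>
     pairing D u (ColS s) = - 1 \<and>
     (\<forall>i\<le>rr D. 0 \<le> pairing D u (ColT i (end_idx D s i)))"

definition horizontal_root :: "'k APdata \<Rightarrow> pole \<Rightarrow> nat \<Rightarrow> nat \<Rightarrow> (nat \<Rightarrow> int) \<Rightarrow> bool" where
  "horizontal_root D s i\<^sub>0 i\<^sub>1 u \<longleftrightarrow>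
     s \<notin> poles D \<and> i\<^sub>0 \<le> rr D \<and> i\<^sub>1 \<le> rr D \<and> i\<^sub>0 \<noteq> i\<^sub>1 \<and> u \<in> lattice_vectors D \<and>
     pole_sign s * u (rr D + 1) < 0 \<and>
     pairing D u (ColT i\<^sub>1 (end_idx D s i\<^sub>1)) = - 1 \<and>
     (\<forall>i\<le>rr D. i \<noteq> i\<^sub>0 \<and> i \<noteq> i\<^sub>1 \<longrightarrow>
        pairing D u (ColT i (end_idx D s i)) = 0 \<and> ell D i (end_idx D s i) = 1) \<and>
     0 \<le> pairing D u (ColT i\<^sub>0 (end_idx D s i\<^sub>0)) \<and>
     (num D i\<^sub>1 > 1 \<longrightarrow> 0 \<le> pairing D u (ColT i\<^sub>1 (next_idx D s i\<^sub>1))) \<and>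
     (\<forall>i\<le>rr D. i \<noteq> i\<^sub>0 \<and> i \<noteq> i\<^sub>1 \<and> num D i > 1 \<longrightarrow>
        int (ell D i (next_idx D s i)) \<le> pairing D u (ColT i (next_idx D s i)))"

text \<open>
  The monomial with exponent vector \<open>e\<close>. It is only used for exponent vectors that are
  nonnegative whenever \<open>u\<close> below is a \<open>P\<close>-root, so that \<open>nat\<close> does not truncate.
\<close>

definition monomial_of :: "'k::field APdata \<Rightarrow> (col \<Rightarrow> int) \<Rightarrow> (col, 'k) mpoly" where
  "monomial_of D e = (\<Prod>c\<in>cols D. Var c ^ nat (e c))"

text \<open>Values on the variables of the derivations arising from \<open>P\<close>-roots. In the vertical case, this is
  \<open>h\<^sup>u S\<close> for the variable \<open>S\<close> of the curve.\<close>

definition vertical_values :: "'k::field APdata \<Rightarrow> pole \<Rightarrow> (nat \<Rightarrow> int) \<Rightarrow> col \<Rightarrow> (col, 'k) mpoly" where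
  "vertical_values D s u c =
     (if c = ColS s then monomial_of D (\<lambda>b. pairing D u b + (if b = ColS s then 1 else 0)) else 0)"

text \<open>\<open>zeta\<close> is the exponent vector of \<open>h\<^sup>\<zeta>\<close>.\<close>

fun zeta :: "'k APdata \<Rightarrow> pole \<Rightarrow> nat \<Rightarrow> nat \<Rightarrow> col \<Rightarrow> int" where
  "zeta D s i\<^sub>0 i\<^sub>1 (ColT i j) =
     (if i = i\<^sub>1 then (if j = end_idx D s i then - 1 else 0)
      else if i = i\<^sub>0 \<or> j = end_idx D s i then 0
      else int (ell D i j))"
| "zeta D s i\<^sub>0 i\<^sub>1 (ColS s') = 0"

definition beta_vec :: "'k::field APdata \<Rightarrow> nat \<Rightarrow> nat \<Rightarrow> nat \<Rightarrow> 'k" where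
  "beta_vec D i\<^sub>0 i\<^sub>1 = (THE \<beta>. \<beta> \<in> extensional {..rr D} \<and>
     (\<exists>x y. \<forall>i\<le>rr D. \<beta> i = x * fst (Acol D i) + y * snd (Acol D i)) \<and>
     \<beta> i\<^sub>0 = 0 \<and> \<beta> i\<^sub>1 = 1)"

definition horizontal_values ::
  "'k::field APdata \<Rightarrow> pole \<Rightarrow> nat \<Rightarrow> nat \<Rightarrow> (nat \<Rightarrow> int) \<Rightarrow> col \<Rightarrow> (col, 'k) mpoly" where
  "horizontal_values D s i\<^sub>0 i\<^sub>1 u c =
     (case c of
        ColT i j \<Rightarrow>
          (if j = end_idx D s i then
             Const (beta_vec D i\<^sub>0 i\<^sub>1 i) *
             monomial_of D (\<lambda>b. pairing D u b - zeta D s i\<^sub>0 i\<^sub>1 b) *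
             (\<Prod>k\<in>{..rr D} - {i, i\<^sub>0}. pdiff (ColT k (end_idx D s k)) (Tpow D k))
           else 0)
      | ColS s' \<Rightarrow> 0)"

text \<open>The automorphism of the affine space of the variables with comorphism \<open>exp (t \<delta>)\<close>, where \<open>\<delta>\<close> has
  values \<open>q\<close> on the variables.\<close>

definition exp_action ::
  "'k::field_char_0 APdata \<Rightarrow> (col \<Rightarrow> (col, 'k) mpoly) \<Rightarrow> 'k \<Rightarrow> (col \<Rightarrow> 'k) \<Rightarrow> col \<Rightarrow> 'k" where
  "exp_action D q t x = (\<lambda>c\<in>cols D. peval x (exp_deriv (deriv_of (cols D) q) t (Var c)))"

text \<open>For a homogeneous \<open>\<delta>\<close> of degree zero the previous map is \<open>H\<close>-equivariant; the induced map on \<open>X\<close> sends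
  an \<open>H\<close>-orbit to its image.\<close>

definition root_aut ::
  "'k::field_char_0 APdata \<Rightarrow> (col \<Rightarrow> (col, 'k) mpoly) \<Rightarrow> 'k \<Rightarrow> (col \<Rightarrow> 'k) set \<Rightarrow> (col \<Rightarrow> 'k) set" where
  "root_aut D q t = (\<lambda>x\<in>points (X_surface D). exp_action D q t ` x)"

definition vertical_root_group ::
  "'k::field_char_0 APdata \<Rightarrow> pole \<Rightarrow> (nat \<Rightarrow> int) \<Rightarrow> ((col \<Rightarrow> 'k) set \<Rightarrow> (col \<Rightarrow> 'k) set) set" where
  "vertical_root_group D s u = range (root_aut D (vertical_values D s u))"

definition horizontal_root_group ::
  "'k::field_char_0 APdata \<Rightarrow> pole \<Rightarrow> nat \<Rightarrow> nat \<Rightarrow> (nat \<Rightarrow> int) \<Rightarrow>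
     ((col \<Rightarrow> 'k) set \<Rightarrow> (col \<Rightarrow> 'k) set) set" where
  "horizontal_root_group D s i\<^sub>0 i\<^sub>1 u = range (root_aut D (horizontal_values D s i\<^sub>0 i\<^sub>1 u))"

definition U_group :: "'k::field_char_0 APdata \<Rightarrow> ((col \<Rightarrow> 'k) set \<Rightarrow> (col \<Rightarrow> 'k) set) set" where
  "U_group D = generate (Aut (X_surface D))
     (\<Union> ({vertical_root_group D s u | s u. vertical_root D s u} \<union>
          {horizontal_root_group D s i\<^sub>0 i\<^sub>1 u | s i\<^sub>0 i\<^sub>1 u. horizontal_root D s i\<^sub>0 i\<^sub>1 u}))"

end

theory Submission
  imports Defs
begin

text \<open>
  Let \<open>u\<close> be a vertical \<open>P\<close>-root at \<open>D\<^sup>+\<close>. Irredundancy makes its pairing with the last column of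
  every arm positive. Scaling \<open>u\<close> and adding a vertical root at \<open>D\<^sup>-\<close> or a horizontal root at \<open>x\<^sup>-\<close>
  thus yields a linear form with nonnegative values on \<open>e\<^sub>0, \<dots>, e\<^sub>r\<close>, not all zero, although
  these vectors sum up to zero. So all roots are vertical at \<open>D\<^sup>+\<close>.

  The root group of \<open>u\<close> acts by \<open>S\<^sup>+ \<mapsto> S\<^sup>+ + t m\<^sub>u\<close>, where the monomial \<open>m\<^sub>u = h\<^sup>u S\<^sup>+\<close> does not involve \<open>S\<^sup>+\<close>.
  If \<open>\<langle>u, v\<^sub>i\<^sub>1\<rangle> \<ge> l\<^sub>i\<^sub>1\<close> for some \<open>i \<noteq> i\<^sub>0, i\<^sub>1\<close>, then \<open>T\<^sub>i\<close> to the power \<open>l\<^sub>i\<close> divides \<open>m\<^sub>u\<close>, and the trinomial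
  relation for \<open>i, i\<^sub>0, i\<^sub>1\<close> writes \<open>m\<^sub>u\<close> on the total coordinate space as a combination of \<open>m\<^sub>u\<^sub>'\<close> and \<open>m\<^sub>u\<^sub>'\<^sub>'\<close> for two roots
  with smaller pairing at \<open>i\<close>; the root automorphism factors accordingly.
\<close>

section \<open>Evaluation and differentiation of polynomials\<close>

definition mon_eval :: "('v \<Rightarrow> 'k::comm_ring_1) \<Rightarrow> ('v \<Rightarrow>\<^sub>0 nat) \<Rightarrow> 'k" where
  "mon_eval x m = (\<Prod>v\<in>Poly_Mapping.keys m. x v ^ Poly_Mapping.lookup m v)"

lemma mon_eval_superset:
  assumes "finite S" "Poly_Mapping.keys m \<subseteq> S"
  shows "mon_eval x m = (\<Prod>v\<in>S. x v ^ Poly_Mapping.lookup m v)"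
  unfolding mon_eval_def
  by (rule prod.mono_neutral_left) (use assms in \<open>auto simp: in_keys_iff\<close>)

lemma mon_eval_add: "mon_eval x (m + n) = mon_eval x m * mon_eval x n"
proof -
  let ?S = "Poly_Mapping.keys m \<union> Poly_Mapping.keys n"
  have "mon_eval x (m + n) = (\<Prod>v\<in>?S. x v ^ Poly_Mapping.lookup (m + n) v)"
    by (rule mon_eval_superset) (use Poly_Mapping.keys_add[of m n] in auto)
  also have "\<dots> = (\<Prod>v\<in>?S. x v ^ Poly_Mapping.lookup m v) * (\<Prod>v\<in>?S. x v ^ Poly_Mapping.lookup n v)"
    by (simp add: lookup_add power_add prod.distrib)
  also have "\<dots> = mon_eval x m * mon_eval x n"
    by (simp add: mon_eval_superset[of ?S])
  finally show ?thesis .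
qed

lemma peval_superset:
  assumes "finite S" "Poly_Mapping.keys f \<subseteq> S"
  shows "peval x f = (\<Sum>m\<in>S. Poly_Mapping.lookup f m * mon_eval x m)"
  unfolding peval_def mon_eval_def[symmetric]
  by (rule sum.mono_neutral_left) (use assms in \<open>auto simp: in_keys_iff\<close>)

lemma peval_0 [simp]: "peval x 0 = 0"
  by (simp add: peval_def)

lemma peval_add: "peval x (f + g) = peval x f + peval x g"
proof -
  let ?S = "Poly_Mapping.keys f \<union> Poly_Mapping.keys g"
  have "peval x (f + g) = (\<Sum>m\<in>?S. Poly_Mapping.lookup (f + g) m * mon_eval x m)"
    by (rule peval_superset) (use Poly_Mapping.keys_add[of f g] in auto)
  then show ?thesis
    by (simp add: peval_superset[of ?S] lookup_add distrib_right sum.distrib)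
qed

lemma peval_sum: "peval x (\<Sum>i\<in>A. f i) = (\<Sum>i\<in>A. peval x (f i))"
  by (induction A rule: infinite_finite_induct) (auto simp: peval_add)

lemma peval_single: "peval x (Poly_Mapping.single m a) = a * mon_eval x m"
  by (subst peval_superset[of "{m}"]) auto

lemma poly_mapping_eq_sum_single:
  "f = (\<Sum>m\<in>Poly_Mapping.keys f. Poly_Mapping.single m (Poly_Mapping.lookup f m))"
  by (rule poly_mapping_eqI) (auto simp: lookup_sum lookup_single when_def in_keys_iff)

lemma peval_mult: "peval x (f * g) = peval x f * peval x g"
proof -
  have "f * g = (\<Sum>m\<in>Poly_Mapping.keys f. \<Sum>n\<in>Poly_Mapping.keys g.
      Poly_Mapping.single (m + n) (Poly_Mapping.lookup f m * Poly_Mapping.lookup g n))"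
    by (subst (1) poly_mapping_eq_sum_single[of f], subst (1) poly_mapping_eq_sum_single[of g])
       (simp add: sum_product mult_single)
  then have "peval x (f * g) = (\<Sum>m\<in>Poly_Mapping.keys f. \<Sum>n\<in>Poly_Mapping.keys g.
      (Poly_Mapping.lookup f m * mon_eval x m) * (Poly_Mapping.lookup g n * mon_eval x n))"
    by (simp add: peval_sum peval_single mon_eval_add mult_ac)
  then show ?thesis
    by (simp add: peval_def mon_eval_def sum_product)
qed

lemma peval_Const [simp]: "peval x (Const a) = a"
  by (simp add: Const_def peval_single mon_eval_def)

lemma peval_1 [simp]: "peval x 1 = 1"
  using peval_Const[of x 1] by (simp add: Const_def)

lemma peval_Var [simp]: "peval x (Var v) = x v"
  by (simp add: Var_def peval_single mon_eval_def)

lemma peval_power: "peval x (f ^ n) = peval x f ^ n"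
  by (induction n) (auto simp: peval_mult)

lemma peval_prod: "peval x (\<Prod>i\<in>A. f i) = (\<Prod>i\<in>A. peval x (f i))"
  by (induction A rule: infinite_finite_induct) (auto simp: peval_mult)

lemma peval_uminus: "peval x (- f) = - peval x f"
  using peval_add[of x f "- f"] by (simp add: eq_neg_iff_add_eq_0 add.commute)

lemma peval_diff: "peval x (f - g) = peval x f - peval x g"
  using peval_add[of x f "- g"] by (simp add: peval_uminus)

text \<open>Substitution of polynomials for the variables of \<open>g\<close>. It pulls back both
  the nonvanishing loci that define open sets and the local fractions that define regular
  functions.\<close>

lemma peval_comp_polynomial:
  assumes "\<And>v. \<exists>p. \<forall>x\<in>Y. \<phi> x v = peval x p"
  shows "\<exists>g'. \<forall>x\<in>Y. peval (\<phi> x) g = peval x g'"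
proof -
  obtain p where p: "\<And>v x. x \<in> Y \<Longrightarrow> \<phi> x v = peval x (p v)"
    using assms by metis
  show ?thesis
    by (rule exI[of _ "\<Sum>m\<in>Poly_Mapping.keys g. Const (Poly_Mapping.lookup g m) *
          (\<Prod>v\<in>Poly_Mapping.keys m. p v ^ Poly_Mapping.lookup m v)"])
       (simp add: peval_sum peval_mult peval_prod peval_power p peval_def[of "\<phi> _"])
qed

section \<open>Derivations and their exponentials\<close>

lemma pdiff_single:
  "pdiff v (Poly_Mapping.single m a) =
     Poly_Mapping.single (m - Poly_Mapping.single v 1) (of_nat (Poly_Mapping.lookup m v) * a)"
  by (cases "a = 0") (simp_all add: pdiff_def)

lemma pdiff_0 [simp]: "pdiff v 0 = 0"
  by (simp add: pdiff_def)

lemma deriv_of_0 [simp]: "deriv_of I q 0 = 0"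
  by (simp add: deriv_of_def)

lemma deriv_of_Var:
  assumes "finite I" "v \<in> I"
  shows "deriv_of I q (Var v) = q v"
proof -
  have "q w * pdiff w (Var v) = (if w = v then q v else 0)" for w
    by (auto simp: Var_def pdiff_single lookup_single when_def)
  with assms show ?thesis
    by (simp add: deriv_of_def)
qed

text \<open>The exponential series stops after its linear term; this is how the derivation of a
  vertical root acts on each variable.\<close>

lemma exp_deriv_square_zero:
  assumes "\<delta> 0 = 0" "\<delta> (\<delta> f) = 0"
  shows "exp_deriv \<delta> s f = f + Const s * \<delta> f"
proof -
  have "(\<delta> ^^ (k + 2)) f = 0" for k
    by (induction k) (simp_all add: assms)
  then have "k < 2" if "(\<delta> ^^ k) f \<noteq> 0" for k
    using that by (metis add.commute le_Suc_ex not_le)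
  then have "{k. (\<delta> ^^ k) f \<noteq> 0} \<subseteq> {0, 1}"
    by (auto simp: less_2_cases_iff)
  then have "exp_deriv \<delta> s f = (\<Sum>k\<in>{0, 1}. Const (s ^ k / fact k) * (\<delta> ^^ k) f)"
    unfolding exp_deriv_def by (intro sum.mono_neutral_left) auto
  then show ?thesis
    by (simp add: Const_def)
qed

lemma Var_power: "Var v ^ n = (Poly_Mapping.single (Poly_Mapping.single v n) 1 :: ('v, 'k::comm_ring_1) mpoly)"
proof (induction n)
  case (Suc n)
  have "Poly_Mapping.single v 1 + Poly_Mapping.single v n = Poly_Mapping.single v (Suc n)"
    by (simp flip: single_add)
  with Suc show ?case
    by (simp add: Var_def mult_single)
qed simp

lemma monomial_of_eq_single:
  "monomial_of D e = Poly_Mapping.single (\<Sum>c\<in>cols D. Poly_Mapping.single c (nat (e c))) 1"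
proof -
  have "(\<Prod>c\<in>A. Poly_Mapping.single (m c) 1) = (Poly_Mapping.single (\<Sum>c\<in>A. m c) 1 :: (col, 'a) mpoly)"
    for A :: "col set" and m
    by (induction A rule: infinite_finite_induct) (simp_all add: mult_single)
  then show ?thesis
    by (simp add: monomial_of_def Var_power)
qed

section \<open>Morphisms\<close>

lemma quasi_affine_regular_cong:
  assumes "regular (quasi_affine Y) U f" "\<And>x. x \<in> U \<Longrightarrow> f x = g x"
  shows "regular (quasi_affine Y) U g"
  using assms by (simp add: quasi_affine_def)

lemma fmorphism_quasi_affine:
  assumes maps: "\<phi> ` Y \<subseteq> Y'" and poly: "\<And>v. \<exists>p. \<forall>x\<in>Y. \<phi> x v = peval x p"
  shows "fmorphism (quasi_affine Y) (quasi_affine Y') \<phi>"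
proof -
  obtain pull where pull: "\<And>g x. x \<in> Y \<Longrightarrow> peval (\<phi> x) g = peval x (pull g)"
    using peval_comp_polynomial[of Y \<phi>, OF poly] by metis
  have op: "zariski_open Y {x \<in> Y. \<phi> x \<in> V}" if V: "zariski_open Y' V" for V
  proof -
    from V obtain F where "V = {x \<in> Y'. \<exists>g\<in>F. peval x g \<noteq> 0}"
      unfolding zariski_open_def by blast
    then have "{x \<in> Y. \<phi> x \<in> V} = {x \<in> Y. \<exists>g\<in>pull ` F. peval x g \<noteq> 0}"
      using maps by (auto simp: pull)
    then show ?thesis
      unfolding zariski_open_def by blast
  qed
  have "\<exists>a b. peval x b \<noteq> 0 \<and>
      (\<forall>y\<in>{x \<in> Y. \<phi> x \<in> V}. peval y b \<noteq> 0 \<longrightarrow> (f \<circ> \<phi>) y = peval y a / peval y b)"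
    if f: "\<forall>x\<in>V. \<exists>a b. peval x b \<noteq> 0 \<and> (\<forall>y\<in>V. peval y b \<noteq> 0 \<longrightarrow> f y = peval y a / peval y b)"
      and x: "x \<in> Y" "\<phi> x \<in> V" for V f x
  proof -
    from f x(2) obtain a b where "peval (\<phi> x) b \<noteq> 0"
      "\<forall>y\<in>V. peval y b \<noteq> 0 \<longrightarrow> f y = peval y a / peval y b" by blast
    then show ?thesis
      using x by (intro exI[of _ "pull a"] exI[of _ "pull b"]) (auto simp flip: pull)
  qed
  with op maps show ?thesis
    by (simp add: fmorphism_def quasi_affine_def)
qed

lemma fmorphismD:
  assumes "fmorphism X Y \<phi>" "is_open Y V"
  shows "is_open X {x \<in> points X. \<phi> x \<in> V}"
    and "regular Y V f \<Longrightarrow> regular X {x \<in> points X. \<phi> x \<in> V} (f \<circ> \<phi>)"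
  using assms by (simp_all add: fmorphism_def)

text \<open>Open sets and functions on the quotient are by definition those on \<open>Y\<close> read
  through \<open>\<pi>\<close>, so a morphism \<open>E\<close> lifting \<open>\<phi>\<close>
  suffices.\<close>

lemma fmorphism_quotient:
  assumes E: "fmorphism (quasi_affine Y) (quasi_affine Y) E"
    and desc: "\<And>y. y \<in> Y \<Longrightarrow> \<phi> (\<pi> y) = \<pi> (E y)"
  shows "fmorphism (quotient_fspace (quasi_affine Y) \<pi>) (quotient_fspace (quasi_affine Y) \<pi>) \<phi>"
proof -
  have pts [simp]: "points (quasi_affine Y) = Y"
    by (simp add: quasi_affine_def)
  have EY: "E y \<in> Y" if "y \<in> Y" for y
    using E that by (auto simp: fmorphism_def)
  have pre: "{y \<in> Y. \<pi> y \<in> \<pi> ` Y \<and> \<phi> (\<pi> y) \<in> V} = {y \<in> Y. E y \<in> {y \<in> Y. \<pi> y \<in> V}}" for V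
    by (rule Collect_cong) (simp add: desc EY imageI del: image_iff cong: conj_cong)
  have op: "is_open (quasi_affine Y) {y \<in> Y. E y \<in> V}" if "is_open (quasi_affine Y) V" for V
    using fmorphismD(1)[OF E that] unfolding pts .
  \<comment> \<open>The lifting property holds on \<open>Y\<close> only, so regularity passes from
    \<open>f \<circ> \<pi> \<circ> E\<close> to \<open>f \<circ> \<phi> \<circ> \<pi>\<close> by
    congruence.\<close>
  have rg: "regular (quasi_affine Y) {y \<in> Y. E y \<in> {y \<in> Y. \<pi> y \<in> V}} (f \<circ> \<phi> \<circ> \<pi>)"
    if "is_open (quasi_affine Y) {y \<in> Y. \<pi> y \<in> V}"
      "regular (quasi_affine Y) {y \<in> Y. \<pi> y \<in> V} (f \<circ> \<pi>)" for V f
  proof (rule quasi_affine_regular_cong)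
    show "regular (quasi_affine Y) {y \<in> Y. E y \<in> {y \<in> Y. \<pi> y \<in> V}} (f \<circ> \<pi> \<circ> E)"
      using fmorphismD(2)[OF E that] unfolding pts .
  qed (simp add: desc)
  show ?thesis
    unfolding fmorphism_def
  proof (intro conjI allI impI; unfold quotient_fspace_def fspace.select_convs pts)
    show "\<phi> ` \<pi> ` Y \<subseteq> \<pi> ` Y"
      using EY by (auto simp: desc)
  next
    fix V assume V: "V \<subseteq> \<pi> ` Y \<and> is_open (quasi_affine Y) {y \<in> Y. \<pi> y \<in> V}"
    show open': "{x \<in> \<pi> ` Y. \<phi> x \<in> V} \<subseteq> \<pi> ` Y \<and>
        is_open (quasi_affine Y) {y \<in> Y. \<pi> y \<in> {x \<in> \<pi> ` Y. \<phi> x \<in> V}}"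
      unfolding mem_Collect_eq[of "\<pi> _"] pre using op V by blast
    fix f assume "V \<subseteq> \<pi> ` Y \<and> is_open (quasi_affine Y) {y \<in> Y. \<pi> y \<in> V} \<and>
        regular (quasi_affine Y) {y \<in> Y. \<pi> y \<in> V} (f \<circ> \<pi>)"
    then have "regular (quasi_affine Y) {y \<in> Y. \<pi> y \<in> {x \<in> \<pi> ` Y. \<phi> x \<in> V}} (f \<circ> \<phi> \<circ> \<pi>)"
      unfolding mem_Collect_eq[of "\<pi> _"] pre by (intro rg) simp_all
    with open' show "{x \<in> \<pi> ` Y. \<phi> x \<in> V} \<subseteq> \<pi> ` Y \<and>
        is_open (quasi_affine Y) {y \<in> Y. \<pi> y \<in> {x \<in> \<pi> ` Y. \<phi> x \<in> V}} \<and>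
        regular (quasi_affine Y) {y \<in> Y. \<pi> y \<in> {x \<in> \<pi> ` Y. \<phi> x \<in> V}} (f \<circ> \<phi> \<circ> \<pi>)"
      by blast
  qed
qed

text \<open>\<open>Aut X\<close> has the multiplication and the unit of the group of bijections of
  the point set; uniqueness of inverses is taken from there.\<close>

lemma inv_Aut_eq:
  assumes "f \<in> carrier (Aut X)" "g \<in> carrier (Aut X)"
    and "f \<otimes>\<^bsub>Aut X\<^esub> g = \<one>\<^bsub>Aut X\<^esub>" "g \<otimes>\<^bsub>Aut X\<^esub> f = \<one>\<^bsub>Aut X\<^esub>"
  shows "inv\<^bsub>Aut X\<^esub> f = g"
proof -
  interpret group "BijGroup (points X)" by (rule group_BijGroup)
  have car: "carrier (Aut X) \<subseteq> carrier (BijGroup (points X))"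
    by (auto simp: Aut_def BijGroup_def Bij_def fisomorphism_def)
  have eqs: "(\<otimes>\<^bsub>Aut X\<^esub>) = (\<otimes>\<^bsub>BijGroup (points X)\<^esub>)" "\<one>\<^bsub>Aut X\<^esub> = \<one>\<^bsub>BijGroup (points X)\<^esub>"
    by (simp_all add: Aut_def)
  show ?thesis
    unfolding m_inv_def
  proof (rule the_equality)
    fix y assume y: "y \<in> carrier (Aut X) \<and> f \<otimes>\<^bsub>Aut X\<^esub> y = \<one>\<^bsub>Aut X\<^esub> \<and> y \<otimes>\<^bsub>Aut X\<^esub> f = \<one>\<^bsub>Aut X\<^esub>"
    then show "y = g"
      using assms car unfolding eqs by (intro inv_unique[of y f g]) auto
  qed (use assms in simp)
qed

section \<open>Arithmetic of the roots\<close>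

text \<open>The linear form \<open>u\<close> evaluated at \<open>e\<^sub>i\<close>, where \<open>e\<^sub>0 = - e\<^sub>1 - \<dots> - e\<^sub>r\<close>.\<close>

definition arm :: "'k APdata \<Rightarrow> (nat \<Rightarrow> int) \<Rightarrow> nat \<Rightarrow> int" where
  "arm D u i = (if i = 0 then - (\<Sum>k\<in>{1..rr D}. u k) else u i)"

lemma sum_arm: "(\<Sum>i\<le>rr D. arm D u i) = 0"
proof -
  have "{..rr D} = insert 0 {1..rr D}" by auto
  then show ?thesis by (simp add: arm_def)
qed

lemma pairing_ColT:
  assumes "i \<le> rr D"
  shows "pairing D u (ColT i j) = int (ell D i j) * arm D u i + dd D i j * u (rr D + 1)"
proof -
  have split: "{1..rr D + 1} = insert (rr D + 1) {1..rr D}" by auto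
  have "(\<Sum>k\<in>{1..rr D}. u k * col_vec D (ColT i j) k) = int (ell D i j) * arm D u i"
  proof (cases "i = 0")
    case True
    have "(\<Sum>k\<in>{1..rr D}. u k * col_vec D (ColT i j) k) = (\<Sum>k\<in>{1..rr D}. - int (ell D i j) * u k)"
      by (rule sum.cong) (auto simp: True unit_vec_def)
    then show ?thesis
      by (simp add: True arm_def sum_negf sum_distrib_left)
  next
    case False
    have "(\<Sum>k\<in>{1..rr D}. u k * col_vec D (ColT i j) k) =
        (\<Sum>k\<in>{1..rr D}. if k = i then int (ell D i j) * u k else 0)"
      by (rule sum.cong) (use False in \<open>auto simp: unit_vec_def\<close>)
    then show ?thesis
      using False assms by (simp add: arm_def)
  qed
  moreover have "col_vec D (ColT i j) (rr D + 1) = dd D i j"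
    using assms by (simp add: unit_vec_def)
  ultimately show ?thesis
    unfolding pairing_def split by simp
qed

lemma pairing_ColS: "pairing D u (ColS s) = pole_sign s * u (rr D + 1)"
proof -
  have "pairing D u (ColS s) = (\<Sum>k\<in>{1..rr D + 1}. if k = rr D + 1 then pole_sign s * u k else 0)"
    unfolding pairing_def by (rule sum.cong) (auto simp: unit_vec_def)
  then show ?thesis by simp
qed

lemma finite_cols [simp]: "finite (cols D)"
proof -
  have "{ColT i j | i j. i \<le> rr D \<and> 1 \<le> j \<and> j \<le> num D i} =
      (\<lambda>(i, j). ColT i j) ` (SIGMA i:{..rr D}. {1..num D i})"
    by auto
  moreover have "finite (ColS ` poles D)"
  proof (rule finite_imageI)
    have "poles D \<subseteq> {Plus, Minus}" by (auto intro: pole.exhaust)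
    then show "finite (poles D)" by (rule finite_subset) simp
  qed
  ultimately show ?thesis by (simp add: cols_def)
qed

lemma vertical_root_Plus_iff:
  "vertical_root D Plus u \<longleftrightarrow>
     Plus \<in> poles D \<and> u \<in> lattice_vectors D \<and> u (rr D + 1) = - 1 \<and>
     (\<forall>i\<le>rr D. 0 \<le> pairing D u (ColT i 1))"
  by (auto simp: vertical_root_def pairing_ColS pole_sign_def end_idx_def)

lemma AP_data_col:
  assumes "AP_data D" "i \<le> rr D" "1 \<le> j" "j \<le> num D i"
  shows "0 < ell D i j" "gcd (int (ell D i j)) (dd D i j) = 1"
proof -
  have "\<forall>i\<le>rr D. \<forall>j\<in>{1..num D i}. 1 \<le> ell D i j \<and> gcd (int (ell D i j)) (dd D i j) = 1"
    using assms(1) unfolding AP_data_def by (elim conjE)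
  then have "1 \<le> ell D i j \<and> gcd (int (ell D i j)) (dd D i j) = 1"
    using assms(2-4) by simp
  then show "0 < ell D i j" "gcd (int (ell D i j)) (dd D i j) = 1"
    by simp_all
qed

lemma AP_data_arm:
  assumes "AP_data D" "i \<le> rr D"
  shows "1 \<le> num D i" "2 \<le> ell D i 1 * num D i"
proof -
  have "\<forall>i\<le>rr D. 1 \<le> num D i" "\<forall>i\<le>rr D. ell D i 1 * num D i \<ge> 2"
    using assms(1) unfolding AP_data_def by - (elim conjE, assumption)+
  then show "1 \<le> num D i" "2 \<le> ell D i 1 * num D i"
    using assms(2) by simp_all
qed

text \<open>The last coordinate of \<open>u\<close> is -1, so the sign of a pairing compares the
  integer \<open>arm D u i\<close> with a slope. This makes the slope ordering applicable.\<close>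

lemma vertical_root_slope:
  assumes "AP_data D" "vertical_root D Plus u" "i \<le> rr D" "1 \<le> j" "j \<le> num D i"
  shows "of_int (pairing D u (ColT i j)) = of_nat (ell D i j) * (of_int (arm D u i) - slope D i j)"
proof -
  have "pairing D u (ColT i j) = int (ell D i j) * arm D u i - dd D i j"
    using assms by (simp add: pairing_ColT vertical_root_Plus_iff)
  moreover have "of_nat (ell D i j) * slope D i j = of_int (dd D i j)"
    using AP_data_col(1)[OF assms(1,3-5)] by (simp add: slope_def)
  ultimately show ?thesis
    by (simp add: right_diff_distrib)
qed

lemma slope_le_first:
  assumes "AP_data D" "i \<le> rr D" "1 \<le> j" "j \<le> num D i"
  shows "slope D i j \<le> slope D i 1" "j \<noteq> 1 \<Longrightarrow> slope D i j < slope D i 1"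
proof -
  have "\<forall>i\<le>rr D. \<forall>j j'. 1 \<le> j \<and> j < j' \<and> j' \<le> num D i \<longrightarrow> slope D i j > slope D i j'"
    using assms(1) unfolding AP_data_def by (elim conjE)
  then have "1 < j \<longrightarrow> slope D i j < slope D i 1"
    using assms(2,4) by simp
  then show "slope D i j \<le> slope D i 1" "j \<noteq> 1 \<Longrightarrow> slope D i j < slope D i 1"
    using assms(3) by (cases "j = 1"; simp)+
qed

lemma first_le_arm:
  assumes "AP_data D" "vertical_root D Plus u" "i \<le> rr D"
  shows "slope D i 1 \<le> of_int (arm D u i)"
proof -
  note n = AP_data_arm(1)[OF assms(1,3)]
  have "0 \<le> (of_int (pairing D u (ColT i 1)) :: rat)"
    using assms by (simp add: vertical_root_Plus_iff)
  then have "0 \<le> (of_nat (ell D i 1) :: rat) * (of_int (arm D u i) - slope D i 1)"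
    unfolding vertical_root_slope[OF assms order.refl n] .
  then show ?thesis
    using AP_data_col(1)[OF assms(1,3) order.refl n] by (simp add: zero_le_mult_iff)
qed

text \<open>The first column has the largest slope of its arm, so a nonnegative pairing there
  propagates along the arm.\<close>

lemma vertical_root_pairing_ColT_nonneg:
  assumes "AP_data D" "vertical_root D Plus u" "i \<le> rr D" "1 \<le> j" "j \<le> num D i"
  shows "0 \<le> pairing D u (ColT i j)"
proof -
  have "0 \<le> (of_int (pairing D u (ColT i j)) :: rat)"
    using slope_le_first(1)[of D i j] first_le_arm[of D u i] assms
    by (simp add: vertical_root_slope)
  then show ?thesis by simp
qed

lemma vertical_root_pairing_nonneg:
  assumes D: "AP_data D" and u: "vertical_root D Plus u" and c: "c \<in> cols D - {ColS Plus}"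
  shows "0 \<le> pairing D u c"
proof (cases c)
  case (ColT i j)
  then show ?thesis
    using vertical_root_pairing_ColT_nonneg[OF D u, of i j] c by (auto simp: cols_def)
next
  case (ColS s)
  then have "s = Minus" using c by (cases s) auto
  then show ?thesis
    using u ColS by (simp add: pairing_ColS pole_sign_def vertical_root_Plus_iff)
qed

text \<open>For a single column in arm \<open>i\<close>, irredundancy makes its slope non-integral.\<close>

lemma vertical_root_pairing_pos:
  assumes "AP_data D" "vertical_root D Plus u" "i \<le> rr D" "1 \<le> j" "j \<le> num D i"
    and "j \<noteq> 1 \<or> num D i = 1"
  shows "1 \<le> pairing D u (ColT i j)"
proof (cases "j = 1")
  case False
  have "0 < (of_int (pairing D u (ColT i j)) :: rat)"
    using slope_le_first(2)[of D i j] first_le_arm[of D u i] AP_data_col(1)[of D i j] False assms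
    by (simp add: vertical_root_slope)
  then show ?thesis by simp
next
  case True
  \<comment> \<open>A zero pairing means that l_{i1} divides d_{i1}. Coprimality leaves l_{i1} = 1,
    and with n_i = 1 this contradicts irredundancy.\<close>
  have "pairing D u (ColT i 1) \<noteq> 0"
  proof
    assume "pairing D u (ColT i 1) = 0"
    then have "int (ell D i 1) dvd dd D i 1"
      using assms(2,3) by (auto simp: pairing_ColT vertical_root_Plus_iff intro: dvdI[of _ _ "arm D u i"])
    then have "gcd (int (ell D i 1)) (dd D i 1) = int (ell D i 1)"
      by (simp add: gcd_proj1_if_dvd)
    moreover have "gcd (int (ell D i 1)) (dd D i 1) = 1"
      using AP_data_col(2)[OF assms(1,3-5)] True by simp
    ultimately show False
      using AP_data_arm(2)[OF assms(1,3)] True assms(6) by simp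
  qed
  then show ?thesis
    using vertical_root_pairing_ColT_nonneg[OF assms(1-5)] True by simp
qed

text \<open>The last column of an arm is either different from the first one or the only
  one.\<close>

lemma vertical_root_last_pairing:
  assumes "AP_data D" "vertical_root D Plus u" "i \<le> rr D"
  shows "1 \<le> int (ell D i (num D i)) * arm D u i - dd D i (num D i)"
proof -
  note AP_data_arm(1)[OF assms(1,3)]
  then have "1 \<le> pairing D u (ColT i (num D i))"
    using assms by (intro vertical_root_pairing_pos) auto
  then show ?thesis
    using assms by (simp add: pairing_ColT vertical_root_Plus_iff)
qed

text \<open>In u + w the last coordinates cancel, so the pairing with the last column of arm i is a
  positive multiple of \<open>arm D u i + arm D w i\<close>. All these numbers are positive, yet
  they sum to zero.\<close>

lemma no_vertical_root_Minus:
  assumes D: "AP_data D" and u: "vertical_root D Plus u" and w: "vertical_root D Minus w"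
  shows False
proof -
  have "w (rr D + 1) = 1"
    using w by (simp add: vertical_root_def pairing_ColS pole_sign_def)
  then have w0: "0 \<le> int (ell D i (num D i)) * arm D w i + dd D i (num D i)" if "i \<le> rr D" for i
    using w that by (simp add: vertical_root_def end_idx_def pairing_ColT)
  have "0 < arm D u i + arm D w i" if "i \<le> rr D" for i
  proof -
    have "0 < int (ell D i (num D i)) * (arm D u i + arm D w i)"
      using vertical_root_last_pairing[OF D u that] w0[OF that] by (simp add: distrib_left)
    then show ?thesis
      by (simp add: zero_less_mult_iff)
  qed
  then have "0 < (\<Sum>i\<le>rr D. arm D u i + arm D w i)"
    by (intro sum_pos) auto
  then show False
    by (simp add: sum.distrib sum_arm)
qed

lemma no_horizontal_root:
  assumes D: "AP_data D" and u: "vertical_root D Plus u" and w: "horizontal_root D s j\<^sub>0 j\<^sub>1 w"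
  shows False
proof -
  have s: "s = Minus"
    using u w by (cases s) (auto simp: vertical_root_def horizontal_root_def)
  \<comment> \<open>The multiple of \<open>u\<close> for which q u + w has last coordinate
    zero.\<close>
  define q where "q = w (rr D + 1)"
  have q: "q > 0" and j: "j\<^sub>0 \<noteq> j\<^sub>1" "j\<^sub>0 \<le> rr D"
    using w by (simp_all add: horizontal_root_def s pole_sign_def q_def)
  define l d where "l i = int (ell D i (num D i))" and "d i = dd D i (num D i)" for i
  have pw: "(if i = j\<^sub>1 then - 1 else 0) \<le> l i * arm D w i + d i * q" if "i \<le> rr D" for i
    using w that unfolding horizontal_root_def s
    by (cases "i = j\<^sub>0"; cases "i = j\<^sub>1")
       (auto simp: end_idx_def pairing_ColT l_def d_def q_def)
  \<comment> \<open>At the arm \<open>j\<^sub>1\<close> the pairing -1 of \<open>w\<close> is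
    absorbed by the contribution of q u, which is at least q >= 1.\<close>
  have pos: "(if i = j\<^sub>1 then - 1 else 0) + q \<le> l i * (q * arm D u i + arm D w i)" if "i \<le> rr D" for i
  proof -
    have "q * 1 \<le> q * (l i * arm D u i - d i)"
      using vertical_root_last_pairing[OF D u that] q by (intro mult_left_mono) (auto simp: l_def d_def)
    with pw[OF that] show ?thesis
      by (simp add: algebra_simps)
  qed
  have l: "l i > 0" if "i \<le> rr D" for i
    using AP_data_col(1)[OF D that _ order.refl] AP_data_arm(1)[OF D that] by (simp add: l_def)
  have "0 \<le> q * arm D u i + arm D w i" if "i \<le> rr D" for i
  proof -
    have "0 \<le> l i * (q * arm D u i + arm D w i)"
      using pos[OF that] q by (auto split: if_splits)
    with l[OF that] show ?thesis by (simp add: zero_le_mult_iff)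
  qed
  \<comment> \<open>Strictness comes from an arm other than \<open>j\<^sub>1\<close>, where the
    lower bound is q > 0.\<close>
  moreover have "0 < q * arm D u j\<^sub>0 + arm D w j\<^sub>0"
  proof -
    have "0 < l j\<^sub>0 * (q * arm D u j\<^sub>0 + arm D w j\<^sub>0)"
      using pos[of j\<^sub>0] j q by simp
    with l[OF j(2)] show ?thesis by (simp add: zero_less_mult_iff)
  qed
  ultimately have "0 < (\<Sum>i\<le>rr D. q * arm D u i + arm D w i)"
    using j by (intro sum_pos2[of _ j\<^sub>0]) auto
  then show False
    by (simp add: sum.distrib sum_arm flip: sum_distrib_left)
qed

section \<open>The action of a vertical root\<close>

abbreviation X_hat :: "'k::field APdata \<Rightarrow> (col \<Rightarrow> 'k) set" where
  "X_hat D \<equiv> X_bar D \<inter> Z_hat D"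

text \<open>The value of m_u = h^u S^+ at a point. The exponent of S^+ is -1 + 1 = 0 for a root at
  D^+, so this column is left out.\<close>

definition vmon :: "'k::field APdata \<Rightarrow> (nat \<Rightarrow> int) \<Rightarrow> (col \<Rightarrow> 'k) \<Rightarrow> 'k" where
  "vmon D u z = (\<Prod>c\<in>cols D - {ColS Plus}. z c ^ nat (pairing D u c))"

definition slide :: "'k::field APdata \<Rightarrow> (nat \<Rightarrow> int) \<Rightarrow> 'k \<Rightarrow> (col \<Rightarrow> 'k) \<Rightarrow> col \<Rightarrow> 'k" where
  "slide D u t z = z(ColS Plus := z (ColS Plus) + t * vmon D u z)"

lemma vmon_slide [simp]: "vmon D w (slide D u t z) = vmon D w z"
  unfolding vmon_def slide_def by (rule prod.cong) auto

text \<open>Changing S^+ does not affect \<open>vmon\<close>, so the increments of successive slides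
  add up. Linear relations between monomials thereby become factorizations.\<close>

lemma slide_slide: "slide D u t (slide D w s z) =
    z(ColS Plus := z (ColS Plus) + (s * vmon D w z + t * vmon D u z))"
  unfolding slide_def[of D u] vmon_slide by (simp add: slide_def add.assoc)

lemma slide_ColT [simp]: "slide D u t z (ColT i j) = z (ColT i j)"
  by (simp add: slide_def)

text \<open>The derivation sends S^+ to m_u and the other variables to 0. As m_u does not involve
  S^+, its square kills every variable.\<close>

lemma exp_action_vertical:
  fixes D :: "'k::field_char_0 APdata"
  assumes u: "vertical_root D Plus u" and z: "z \<in> affine_space (cols D)"
  shows "exp_action D (vertical_values D Plus u) t z = slide D u t z"
proof
  let ?q = "vertical_values D Plus u :: col \<Rightarrow> (col, 'k) mpoly"
  let ?e = "\<lambda>b. pairing D u b + (if b = ColS Plus then 1 else 0)"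
  have P: "ColS Plus \<in> cols D" "pairing D u (ColS Plus) = - 1"
    using u by (auto simp: vertical_root_def cols_def)
  have pd: "pdiff (ColS Plus) (monomial_of D ?e :: (col, 'k) mpoly) = 0"
  proof -
    have "Poly_Mapping.lookup (\<Sum>c\<in>cols D. Poly_Mapping.single c (nat (?e c))) (ColS Plus) = 0"
      using P by (simp add: lookup_sum lookup_single when_def)
    then show ?thesis
      by (simp add: monomial_of_eq_single pdiff_single)
  qed
  have nil: "deriv_of (cols D) ?q (?q c) = 0" for c
  proof -
    have "?q v * pdiff v (?q c) = 0" for v
      by (simp add: vertical_values_def pd)
    then show ?thesis
      by (simp add: deriv_of_def)
  qed
  have mon: "peval z (monomial_of D ?e) = vmon D u z"
  proof -
    have "peval z (monomial_of D ?e) = (\<Prod>c\<in>cols D. z c ^ nat (?e c))"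
      by (simp add: monomial_of_def peval_prod peval_power)
    also have "\<dots> = z (ColS Plus) ^ nat (?e (ColS Plus)) * (\<Prod>c\<in>cols D - {ColS Plus}. z c ^ nat (?e c))"
      using P(1) by (intro prod.remove) auto
    finally show ?thesis
      by (simp add: P(2) vmon_def)
  qed
  fix c
  show "exp_action D ?q t z c = slide D u t z c"
  proof (cases "c \<in> cols D")
    case True
    then have "exp_deriv (deriv_of (cols D) ?q) t (Var c) = Var c + Const t * ?q c"
      by (subst exp_deriv_square_zero) (simp_all add: deriv_of_Var nil)
    then have "exp_action D ?q t z c = z c + t * peval z (?q c)"
      using True by (simp add: exp_action_def peval_add peval_mult)
    then show ?thesis
      by (simp add: vertical_values_def slide_def mon)
  next
    \<comment> \<open>Outside \<open>cols D\<close> both sides take the default value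
      \<open>undefined\<close>.\<close>
    case False
    then show ?thesis
      using z P(1) by (auto simp: exp_action_def affine_space_def slide_def)
  qed
qed

text \<open>The relation defining \<open>H_group D\<close> has exponent -1 at S^+ for
  \<open>u\<close>, so it says that m_u takes the value h(S^+) at h. Hence m_u and S^+ have the same
  degree in Cl(Z).\<close>

lemma slide_H:
  assumes D: "AP_data D" and u: "vertical_root D Plus u" and h: "h \<in> H_group D"
  shows "slide D u t (\<lambda>c\<in>cols D. h c * z c) = (\<lambda>c\<in>cols D. h c * slide D u t z c)"
proof -
  have P: "ColS Plus \<in> cols D" "pairing D u (ColS Plus) = - 1"
    using u by (auto simp: vertical_root_def cols_def)
  have "(\<Prod>c\<in>cols D. h c powi pairing D u c) = 1"
    using h u by (auto simp: H_group_def vertical_root_def)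
  also have "(\<Prod>c\<in>cols D. h c powi pairing D u c) =
      h (ColS Plus) powi (- 1) * (\<Prod>c\<in>cols D - {ColS Plus}. h c powi pairing D u c)"
    using P prod.remove[of "cols D" "ColS Plus" "\<lambda>c. h c powi pairing D u c"] by simp
  also have "(\<Prod>c\<in>cols D - {ColS Plus}. h c powi pairing D u c) = vmon D u h"
    unfolding vmon_def by (rule prod.cong) (use vertical_root_pairing_nonneg[OF D u] in \<open>auto simp: power_int_def\<close>)
  finally have "vmon D u h = h (ColS Plus)"
    using h P(1) by (auto simp: H_group_def power_int_minus field_simps)
  moreover have "vmon D u (\<lambda>c\<in>cols D. h c * z c) = vmon D u h * vmon D u z"
    unfolding vmon_def prod.distrib[symmetric]
    by (rule prod.cong) (auto simp: power_mult_distrib)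
  ultimately show ?thesis
    using P(1) by (auto simp: slide_def fun_eq_iff algebra_simps)
qed

lemma slide_cox:
  assumes "AP_data D" "vertical_root D Plus u"
  shows "slide D u t ` cox_quotient D z = cox_quotient D (slide D u t z)"
  unfolding cox_quotient_def image_image
  by (rule image_cong) (simp_all add: slide_H[OF assms])

lemma peval_Tpow: "peval z (Tpow D i) = (\<Prod>j\<in>{1..num D i}. z (ColT i j) ^ ell D i j)"
  by (simp add: Tpow_def peval_prod peval_power)

lemma peval_trinomial:
  "peval z (trinomial D i j k) =
     peval z (Tpow D i) * (fst (Acol D j) * snd (Acol D k) - fst (Acol D k) * snd (Acol D j)) -
     peval z (Tpow D j) * (fst (Acol D i) * snd (Acol D k) - fst (Acol D k) * snd (Acol D i)) +
     peval z (Tpow D k) * (fst (Acol D i) * snd (Acol D j) - fst (Acol D j) * snd (Acol D i))"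
  by (simp add: trinomial_def det_3 peval_add peval_diff peval_mult algebra_simps)

text \<open>The trinomials do not involve S^+, so the point at issue is \<open>Z_hat D\<close>: the
  coordinate S^+ may become zero.\<close>

lemma slide_in_X_hat:
  assumes D: "AP_data D" and u: "vertical_root D Plus u" and z: "z \<in> X_hat D"
  shows "slide D u t z \<in> X_hat D"
proof -
  have P: "ColS Plus \<in> cols D" "Plus \<in> poles D"
    using u by (auto simp: vertical_root_def cols_def)
  have aff: "slide D u t z \<in> affine_space (cols D)"
    using z P(1) by (auto simp: X_bar_def affine_space_def slide_def PiE_def extensional_def)
  have "slide D u t z \<in> X_bar D"
    using z aff by (auto simp: X_bar_def peval_trinomial peval_Tpow)
  moreover have "slide D u t z \<in> Z_hat D"
  proof -
    obtain \<sigma> where \<sigma>: "\<sigma> \<in> max_cones D" "\<And>c. c \<in> cols D - \<sigma> \<Longrightarrow> z c \<noteq> 0"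
      using z by (auto simp: Z_hat_def)
    show ?thesis
    proof (cases "slide D u t z (ColS Plus) = 0 \<and> ColS Plus \<notin> \<sigma>")
      \<comment> \<open>The cone \<open>\<sigma>\<close> still serves: the only changed coordinate
        is nonzero or belongs to \<open>\<sigma>\<close>.\<close>
      case False
      then have "slide D u t z c \<noteq> 0" if "c \<in> cols D - \<sigma>" for c
        using \<sigma>(2)[OF that] that by (cases "c = ColS Plus") (auto simp: slide_def)
      then show ?thesis
        using aff \<sigma>(1) by (auto simp: Z_hat_def)
    next
      txt \<open>If the new \<open>S\<^sup>+\<close> vanishes, then \<open>m\<^sub>u\<close> does not, so that besides \<open>S\<^sup>+\<close> at most one \<open>T\<^sub>i\<^sub>1\<close> is
        zero and the point moves to the chart of \<open>cone(v\<^sup>+, v\<^sub>i\<^sub>1)\<close>.\<close>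
      case True
      then have "vmon D u z \<noteq> 0"
        using \<sigma>(2)[of "ColS Plus"] P by (auto simp: slide_def)
      then have nz: "z c \<noteq> 0" if "c \<in> cols D" "c \<noteq> ColS Plus" "1 \<le> pairing D u c" for c
        using that by (auto simp: vmon_def power_0_left)
      have col: "z (ColT i j) \<noteq> 0" if "i \<le> rr D" "1 \<le> j" "j \<le> num D i" "j \<noteq> 1 \<or> num D i = 1" for i j
        using that vertical_root_pairing_pos[OF D u, of i j] by (intro nz) (auto simp: cols_def)
      have minus: "z (ColS Minus) \<noteq> 0" if "Minus \<in> poles D"
        using that u
        by (intro nz) (auto simp: cols_def pairing_ColS pole_sign_def vertical_root_Plus_iff)
      have sink: "s = Minus" if "s \<notin> poles D" for s
        using that P(2) by (cases s) auto
      \<comment> \<open>A maximal cone contains the first column of at most one arm with several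
        columns: \<open>\<sigma>\<^sup>+\<close> does not occur since v^+ is present, and
        \<open>\<sigma>\<^sup>-\<close> consists of last columns.\<close>
      have "\<exists>i\<^sub>0\<le>rr D. \<forall>i\<le>rr D. i \<noteq> i\<^sub>0 \<and> 1 < num D i \<longrightarrow> z (ColT i 1) \<noteq> 0"
      proof -
        consider i j where "i \<le> rr D" "\<sigma> = {ColT i j, ColT i (j + 1)}"
          | s i where "i \<le> rr D" "\<sigma> = {ColS s, ColT i (end_idx D s i)}"
          | s where "s \<notin> poles D" "\<sigma> = {ColT i (end_idx D s i) | i. i \<le> rr D}"
          using \<sigma>(1) unfolding max_cones_def by blast
        then have "\<exists>i\<^sub>0\<le>rr D. \<forall>i\<le>rr D. i \<noteq> i\<^sub>0 \<and> 1 < num D i \<longrightarrow> ColT i 1 \<notin> \<sigma>"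
        proof cases
          case 3
          with sink[OF 3(1)] show ?thesis by (auto simp: end_idx_def)
        qed auto
        moreover have "z (ColT i 1) \<noteq> 0" if "i \<le> rr D" "1 < num D i" "ColT i 1 \<notin> \<sigma>" for i
          using \<sigma>(2)[of "ColT i 1"] that by (simp add: cols_def)
        ultimately show ?thesis by blast
      qed
      then obtain i\<^sub>0 where i0: "i\<^sub>0 \<le> rr D"
        "\<And>i. i \<le> rr D \<Longrightarrow> i \<noteq> i\<^sub>0 \<Longrightarrow> 1 < num D i \<Longrightarrow> z (ColT i 1) \<noteq> 0" by auto
      have "slide D u t z c \<noteq> 0" if c: "c \<in> cols D - {ColS Plus, ColT i\<^sub>0 1}" for c
      proof (cases c)
        case (ColT i j)
        then have ij: "i \<le> rr D" "1 \<le> j" "j \<le> num D i" "j \<noteq> 1 \<or> i \<noteq> i\<^sub>0"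
          using c by (auto simp: cols_def)
        consider "j \<noteq> 1 \<or> num D i = 1" | "j = 1" "i \<noteq> i\<^sub>0" "1 < num D i"
          using ij by linarith
        then show ?thesis
          by cases (use col[OF ij(1-3)] i0(2)[OF ij(1)] ColT in simp_all)
      next
        case (ColS s)
        with c have "s = Minus" by (cases s) auto
        with ColS c minus show ?thesis by (auto simp: cols_def slide_def)
      qed
      moreover have "{ColS Plus, ColT i\<^sub>0 1} \<in> max_cones D"
        using P(2) i0(1) by (auto simp: max_cones_def end_idx_def intro!: exI[of _ Plus] exI[of _ i\<^sub>0])
      ultimately show ?thesis
        using aff unfolding Z_hat_def by blast
    qed
  qed
  ultimately show ?thesis by simp
qed

section \<open>Root automorphisms of the surface\<close>

lemma points_X_surface: "points (X_surface D) = cox_quotient D ` X_hat D"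
  by (simp add: X_surface_def quotient_fspace_def quasi_affine_def)

text \<open>Points of the surface are H-orbits; this rule computes root automorphisms on
  representatives in Cox coordinates.\<close>

lemma root_aut_cox:
  fixes D :: "'k::field_char_0 APdata"
  assumes "AP_data D" "vertical_root D Plus u" "z \<in> X_hat D"
  shows "root_aut D (vertical_values D Plus u) t (cox_quotient D z) = cox_quotient D (slide D u t z)"
proof -
  have "cox_quotient D z \<subseteq> affine_space (cols D)"
    by (auto simp: cox_quotient_def affine_space_def)
  then have "exp_action D (vertical_values D Plus u) t ` cox_quotient D z = slide D u t ` cox_quotient D z"
    by (intro image_cong) (auto simp: exp_action_vertical[OF assms(2)])
  then show ?thesis
    using assms by (simp add: root_aut_def points_X_surface slide_cox)
qed

lemma fmorphism_slide:
  assumes "AP_data D" "vertical_root D Plus u"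
  shows "fmorphism (quasi_affine (X_hat D)) (quasi_affine (X_hat D)) (slide D u t)"
proof (rule fmorphism_quasi_affine)
  show "slide D u t ` X_hat D \<subseteq> X_hat D"
    using slide_in_X_hat[OF assms] by blast
  fix v
  let ?p = "if v = ColS Plus
    then Var v + Const t * (\<Prod>c\<in>cols D - {ColS Plus}. Var c ^ nat (pairing D u c)) else Var v"
  show "\<exists>p. \<forall>x\<in>X_hat D. slide D u t x v = peval x p"
    by (rule exI[of _ ?p])
       (simp add: slide_def vmon_def peval_add peval_mult peval_prod peval_power)
qed

text \<open>The parameter -t gives the inverse, and both maps lift to polynomial maps of
  \<open>X_hat D\<close>.\<close>

lemma root_aut_in_Aut:
  fixes D :: "'k::field_char_0 APdata"
  assumes D: "AP_data D" and u: "vertical_root D Plus u"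
  shows "root_aut D (vertical_values D Plus u) t \<in> carrier (Aut (X_surface D))"
proof -
  let ?f = "root_aut D (vertical_values D Plus u)"
  let ?X = "points (X_surface D)"
  have maps: "?f s x \<in> ?X" "?f s (?f (- s) x) = x" if x: "x \<in> ?X" for s x
  proof -
    obtain z where z: "z \<in> X_hat D" "x = cox_quotient D z"
      using x by (auto simp: points_X_surface)
    then show "?f s x \<in> ?X" "?f s (?f (- s) x) = x"
      using slide_in_X_hat[OF D u z(1)]
      by (auto simp: root_aut_cox[OF D u] points_X_surface slide_slide)
  qed
  have bij: "bij_betw (?f t) ?X ?X"
    by (rule bij_betw_byWitness[of _ "?f (- t)"]) (use maps maps(2)[of _ "- t"] in auto)
  have "fmorphism (X_surface D) (X_surface D) (?f t)"
    unfolding X_surface_def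
    by (rule fmorphism_quotient[OF fmorphism_slide[OF D u]]) (rule root_aut_cox[OF D u])
  moreover have "fmorphism (X_surface D) (X_surface D) (inv_into ?X (?f t))"
    unfolding X_surface_def
  proof (rule fmorphism_quotient[OF fmorphism_slide[OF D u]], fold X_surface_def)
    fix z assume z: "z \<in> X_hat D"
    show "inv_into ?X (?f t) (cox_quotient D z) = cox_quotient D (slide D u (- t) z)"
      by (rule inv_into_f_eq)
         (use bij z slide_in_X_hat[OF D u z]
           in \<open>auto simp: bij_betw_def points_X_surface root_aut_cox[OF D u] slide_slide\<close>)
  qed
  ultimately show ?thesis
    using bij by (simp add: Aut_def fisomorphism_def root_aut_def)
qed

lemma Aut_mult:
  assumes "f \<in> carrier (Aut X)" "g \<in> carrier (Aut X)"
  shows "f \<otimes>\<^bsub>Aut X\<^esub> g = compose (points X) f g"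
  using assms by (auto simp: Aut_def BijGroup_def Bij_def fisomorphism_def)

text \<open>The increments of S^+ on the two sides agree at each point of \<open>X_hat D\<close>.
  With all three roots equal this is the group law of a root group.\<close>

lemma root_aut_eq_mult:
  fixes D :: "'k::field_char_0 APdata"
  assumes D: "AP_data D"
    and roots: "vertical_root D Plus u" "vertical_root D Plus w\<^sub>1" "vertical_root D Plus w\<^sub>2"
    and eq: "\<And>z. z \<in> X_hat D \<Longrightarrow> t * vmon D u z = s\<^sub>1 * vmon D w\<^sub>1 z + s\<^sub>2 * vmon D w\<^sub>2 z"
  shows "root_aut D (vertical_values D Plus u) t =
    root_aut D (vertical_values D Plus w\<^sub>1) s\<^sub>1 \<otimes>\<^bsub>Aut (X_surface D)\<^esub> root_aut D (vertical_values D Plus w\<^sub>2) s\<^sub>2"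
proof -
  have "root_aut D (vertical_values D Plus u) t x =
      root_aut D (vertical_values D Plus w\<^sub>1) s\<^sub>1 (root_aut D (vertical_values D Plus w\<^sub>2) s\<^sub>2 x)"
    if "x \<in> points (X_surface D)" for x
  proof -
    obtain z where z: "z \<in> X_hat D" "x = cox_quotient D z"
      using \<open>x \<in> points (X_surface D)\<close> by (auto simp: points_X_surface)
    have "slide D w\<^sub>1 s\<^sub>1 (slide D w\<^sub>2 s\<^sub>2 z) = slide D u t z"
      by (simp add: slide_slide slide_def[of D u] eq[OF z(1)] add.commute)
    then show ?thesis
      using z slide_in_X_hat[OF D roots(3) z(1)] by (simp add: root_aut_cox[OF D] roots)
  qed
  then have "root_aut D (vertical_values D Plus u) t = compose (points (X_surface D))
      (root_aut D (vertical_values D Plus w\<^sub>1) s\<^sub>1) (root_aut D (vertical_values D Plus w\<^sub>2) s\<^sub>2)"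
    by (intro extensionalityI[of _ "points (X_surface D)"])
       (simp_all add: compose_eq root_aut_def[of D "vertical_values D Plus u"] compose_extensional)
  then show ?thesis
    by (simp add: Aut_mult root_aut_in_Aut[OF D] roots)
qed

lemma root_aut_0:
  fixes D :: "'k::field_char_0 APdata"
  assumes D: "AP_data D" and u: "vertical_root D Plus u"
  shows "root_aut D (vertical_values D Plus u) 0 = \<one>\<^bsub>Aut (X_surface D)\<^esub>"
proof -
  have "root_aut D (vertical_values D Plus u) 0 x = x" if "x \<in> points (X_surface D)" for x
    using that by (auto simp: points_X_surface root_aut_cox[OF D u] slide_def)
  then show ?thesis
    by (intro extensionalityI[of _ "points (X_surface D)"])
       (simp_all add: Aut_def BijGroup_def root_aut_def[of D "vertical_values D Plus u"])
qed

lemma inv_root_aut: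
  fixes D :: "'k::field_char_0 APdata"
  assumes D: "AP_data D" and u: "vertical_root D Plus u"
  shows "inv\<^bsub>Aut (X_surface D)\<^esub> root_aut D (vertical_values D Plus u) t =
    root_aut D (vertical_values D Plus u) (- t)"
proof -
  \<comment> \<open>The relation behind this is 0 = s m_u + (-s) m_u. Taking s = t and s = -t yields
    a two-sided inverse.\<close>
  have "root_aut D (vertical_values D Plus u) s \<otimes>\<^bsub>Aut (X_surface D)\<^esub>
      root_aut D (vertical_values D Plus u) (- s) = \<one>\<^bsub>Aut (X_surface D)\<^esub>" for s
    unfolding root_aut_0[OF D u, symmetric] by (rule root_aut_eq_mult[symmetric]) (simp_all add: D u)
  from this[of t] this[of "- t"] show ?thesis
    by (intro inv_Aut_eq root_aut_in_Aut[OF D u]) simp_all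
qed

section \<open>Reduction by the trinomial relations\<close>

text \<open>Up to sign, the i-th power has the minor of the columns j and k of A as its coefficient
  in the trinomial, and this minor is nonzero.\<close>

lemma trinomial_relation:
  fixes D :: "'k::field APdata"
  assumes D: "AP_data D" and idx: "i \<le> rr D" "j \<le> rr D" "k \<le> rr D" "i \<noteq> j" "i \<noteq> k" "j \<noteq> k"
  shows "\<exists>a b. \<forall>z\<in>X_hat D. peval z (Tpow D i) = a * peval z (Tpow D j) + b * peval z (Tpow D k)"
proof -
  define \<Delta> where "\<Delta> p q = fst (Acol D p) * snd (Acol D q) - fst (Acol D q) * snd (Acol D p)" for p q
  have anti: "\<Delta> p q = - \<Delta> q p" for p q
    by (simp add: \<Delta>_def)
  have nz: "\<Delta> j k \<noteq> 0"
  proof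
    assume 0: "\<Delta> j k = 0"
    have indep: "\<forall>i\<le>rr D. \<forall>j\<le>rr D. i \<noteq> j \<longrightarrow>
        (\<forall>x y. x * fst (Acol D i) + y * fst (Acol D j) = 0 \<and>
               x * snd (Acol D i) + y * snd (Acol D j) = 0 \<longrightarrow> x = 0 \<and> y = 0)"
      using D unfolding AP_data_def by (elim conjE)
    \<comment> \<open>If the minor vanishes, these coefficients give linear relations between the
      columns j and k, which force column k to be zero.\<close>
    have "snd (Acol D k) = 0" "fst (Acol D k) = 0"
      using indep[rule_format, OF idx(2,3,6), of "snd (Acol D k)" "- snd (Acol D j)"]
        indep[rule_format, OF idx(2,3,6), of "fst (Acol D k)" "- fst (Acol D j)"] 0
      by (auto simp: \<Delta>_def algebra_simps)
    then show False
      using indep[rule_format, OF idx(2,3,6), of 0 1] by simp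
  qed
  have rel: "peval z (Tpow D i) * \<Delta> j k - peval z (Tpow D j) * \<Delta> i k + peval z (Tpow D k) * \<Delta> i j = 0"
    if z: "z \<in> X_hat D" for z
  proof -
    \<comment> \<open>Trinomials are given for increasing indices; antisymmetry of
      \<open>\<Delta>\<close> extends the relation to every order of i, j, k.\<close>
    have sorted: "peval z (Tpow D p) * \<Delta> q s - peval z (Tpow D q) * \<Delta> p s + peval z (Tpow D s) * \<Delta> p q = 0"
      if "p < q" "q < s" "s \<le> rr D" for p q s
      using z that unfolding X_bar_def \<Delta>_def peval_trinomial[symmetric] by blast
    consider "i < j" "j < k" | "i < k" "k < j" | "j < i" "i < k" | "j < k" "k < i" | "k < i" "i < j" | "k < j" "j < i"
      using idx(4-6) by linarith
    then show ?thesis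
      using idx(1-3) sorted anti[of j i] anti[of k i] anti[of k j]
      by cases (fastforce simp: algebra_simps)+
  qed
  have "peval z (Tpow D i) = \<Delta> i k / \<Delta> j k * peval z (Tpow D j) + (- \<Delta> i j / \<Delta> j k) * peval z (Tpow D k)"
    if "z \<in> X_hat D" for z
    using rel[OF that] nz by (simp add: field_simps)
  then show ?thesis by blast
qed

text \<open>Adds the \<open>k\<close>-th and subtracts the \<open>i\<close>-th vector of the basis dual to \<open>e\<^sub>1, \<dots>, e\<^sub>r\<^sub>+\<^sub>1\<close>, where index
  \<open>0\<close> contributes nothing; in terms of \<open>arm\<close> all indices \<open>0, \<dots>, r\<close> play the same role.\<close>

definition transfer :: "nat \<Rightarrow> nat \<Rightarrow> (nat \<Rightarrow> int) \<Rightarrow> nat \<Rightarrow> int" where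
  "transfer i k u m =
     u m + (if m = k \<and> k \<noteq> 0 then 1 else 0) - (if m = i \<and> i \<noteq> 0 then 1 else 0)"

lemma arm_transfer:
  assumes "i \<le> rr D" "k \<le> rr D"
  shows "arm D (transfer i k u) j = arm D u j + (if j = k then 1 else 0) - (if j = i then 1 else 0)"
proof -
  have "(\<Sum>m\<in>{1..rr D}. if m = p \<and> p \<noteq> 0 then 1 else 0 :: int) = (if p = 0 then 0 else 1)"
    if "p \<le> rr D" for p
    using that by (cases "p = 0") auto
  with assms show ?thesis
    by (auto simp: arm_def transfer_def sum.distrib sum_subtractf)
qed

text \<open>The exponent vector of the monomial \<open>Tpow D k\<close>.\<close>

fun arm_exponent :: "'k APdata \<Rightarrow> nat \<Rightarrow> col \<Rightarrow> int" where
  "arm_exponent D k (ColT i j) = (if i = k then int (ell D i j) else 0)"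
| "arm_exponent D k (ColS s) = 0"

lemma arm_exponent_nonneg: "0 \<le> arm_exponent D k c"
  by (cases c) auto

text \<open>In terms of monomials, h^u is divided by \<open>Tpow D i\<close> and multiplied by
  \<open>Tpow D k\<close>.\<close>

lemma pairing_transfer:
  assumes "i \<le> rr D" "k \<le> rr D" "c \<in> cols D"
  shows "pairing D (transfer i k u) c = pairing D u c + arm_exponent D k c - arm_exponent D i c"
proof (cases c)
  case (ColT j m)
  then have "j \<le> rr D" using assms(3) by (auto simp: cols_def)
  with assms ColT show ?thesis
    by (simp add: pairing_ColT arm_transfer) (simp add: transfer_def algebra_simps)
qed (use assms in \<open>simp add: pairing_ColS transfer_def\<close>)

text \<open>The last coordinate stays -1, and only pairings in arm i can drop. At its first column
  the drop is at most l_{i1}, which \<open>large\<close> covers.\<close>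

lemma vertical_root_transfer:
  assumes D: "AP_data D" and u: "vertical_root D Plus u" and idx: "i \<le> rr D" "k \<le> rr D"
    and large: "int (ell D i 1) \<le> pairing D u (ColT i 1)"
  shows "vertical_root D Plus (transfer i k u)"
proof -
  have "transfer i k u \<in> lattice_vectors D" "transfer i k u (rr D + 1) = - 1"
    using u idx by (auto simp: vertical_root_Plus_iff lattice_vectors_def transfer_def)
  moreover have "0 \<le> pairing D (transfer i k u) (ColT j 1)" if "j \<le> rr D" for j
  proof -
    have "ColT j 1 \<in> cols D"
      using that AP_data_arm(1)[OF D that] by (auto simp: cols_def)
    moreover have "0 \<le> pairing D u (ColT j 1)"
      using u that by (simp add: vertical_root_Plus_iff)
    ultimately show ?thesis
      using large arm_exponent_nonneg[of D k "ColT j 1"] by (auto simp: pairing_transfer[OF idx])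
  qed
  ultimately show ?thesis
    using u by (simp add: vertical_root_Plus_iff)
qed

lemma prod_arm_exponent:
  assumes "k \<le> rr D"
  shows "(\<Prod>c\<in>cols D - {ColS Plus}. z c ^ nat (arm_exponent D k c)) = peval z (Tpow D k)"
proof -
  have "(\<Prod>c\<in>cols D - {ColS Plus}. z c ^ nat (arm_exponent D k c)) =
      (\<Prod>c\<in>ColT k ` {1..num D k}. z c ^ nat (arm_exponent D k c))"
  proof (rule prod.mono_neutral_right)
    show "\<forall>c\<in>cols D - {ColS Plus} - ColT k ` {1..num D k}. z c ^ nat (arm_exponent D k c) = 1"
    proof
      fix c assume c: "c \<in> cols D - {ColS Plus} - ColT k ` {1..num D k}"
      show "z c ^ nat (arm_exponent D k c) = 1"
        using c by (cases c) (auto simp: cols_def)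
    qed
  qed (use assms in \<open>simp, auto simp: cols_def\<close>)
  also have "\<dots> = peval z (Tpow D k)"
    by (subst prod.reindex) (auto simp: inj_on_def peval_Tpow)
  finally show ?thesis .
qed

text \<open>The cofactor \<open>b\<close> is m_u divided by \<open>Tpow D i\<close>. It is the same
  for all k, so a trinomial relation can be multiplied by it.\<close>

lemma vmon_transfer:
  assumes D: "AP_data D" and u: "vertical_root D Plus u" and i: "i \<le> rr D"
    and large: "int (ell D i 1) \<le> pairing D u (ColT i 1)"
  shows "\<exists>b. vmon D u z = b * peval z (Tpow D i) \<and>
    (\<forall>k\<le>rr D. k \<noteq> i \<longrightarrow> vmon D (transfer i k u) z = b * peval z (Tpow D k))"
proof -
  define e where "e c = pairing D u c - arm_exponent D i c" for c
  have factor: "vmon D w z = (\<Prod>c\<in>cols D - {ColS Plus}. z c ^ nat (e c)) * peval z (Tpow D k)"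
    if k: "k \<le> rr D" and e0: "\<And>c. c \<in> cols D - {ColS Plus} \<Longrightarrow> 0 \<le> e c"
      and w: "\<And>c. c \<in> cols D - {ColS Plus} \<Longrightarrow> pairing D w c = e c + arm_exponent D k c" for w k
    unfolding vmon_def prod_arm_exponent[OF k, symmetric] prod.distrib[symmetric]
    by (rule prod.cong) (auto simp: w e0 nat_add_distrib arm_exponent_nonneg power_add)
  have "1 \<le> rr D"
    using D unfolding AP_data_def by (elim conjE)
  then have "\<exists>k. k \<le> rr D \<and> k \<noteq> i"
    by (intro exI[of _ "if i = 0 then 1 else 0"]) auto
  then obtain k where k: "k \<le> rr D" "k \<noteq> i" by blast
  \<comment> \<open>\<open>large\<close> concerns the first column of arm i only. On the whole arm,
    \<open>e\<close> is the pairing with the root \<open>transfer i k u\<close>, where k differs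
    from i, and hence nonnegative.\<close>
  have nonneg: "0 \<le> e c" if c: "c \<in> cols D - {ColS Plus}" for c
  proof -
    have "0 \<le> pairing D (transfer i k u) c" "0 \<le> pairing D u c"
      using vertical_root_pairing_nonneg[OF D _ c] vertical_root_transfer[OF D u i k(1) large] u by blast+
    then show ?thesis
      using k c by (cases c) (auto simp: pairing_transfer[OF i k(1)] e_def split: if_splits)
  qed
  have "vmon D u z = (\<Prod>c\<in>cols D - {ColS Plus}. z c ^ nat (e c)) * peval z (Tpow D i)"
    by (rule factor[OF i nonneg]) (simp_all add: e_def)
  moreover have "vmon D (transfer i k u) z =
      (\<Prod>c\<in>cols D - {ColS Plus}. z c ^ nat (e c)) * peval z (Tpow D k)" if "k \<le> rr D" for k
    by (rule factor[OF that nonneg]) (simp_all add: e_def pairing_transfer[OF i that])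
  ultimately show ?thesis by blast
qed

text \<open>Induction on the sum of the pairings with the first columns of the arms other than
  \<open>i\<^sub>0\<close>, \<open>i\<^sub>1\<close>. A transfer from i to one of these two arms
  lowers the summand of i by l_{i1} > 0 and raises pairings outside the sum only.\<close>

lemma root_aut_in_generate_reduced:
  fixes D :: "'k::field_char_0 APdata"
  assumes D: "AP_data D" and idx: "i\<^sub>0 \<le> rr D" "i\<^sub>1 \<le> rr D" "i\<^sub>0 \<noteq> i\<^sub>1"
    and u: "vertical_root D Plus u"
  shows "root_aut D (vertical_values D Plus u) t \<in> generate (Aut (X_surface D))
           (\<Union> {vertical_root_group D Plus u | u.
                 vertical_root D Plus u \<and>
                 (\<forall>i\<le>rr D. i \<noteq> i\<^sub>0 \<and> i \<noteq> i\<^sub>1 \<longrightarrow>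
                    0 \<le> pairing D u (ColT i 1) \<and>
                    pairing D u (ColT i 1) < int (ell D i 1))})" (is "_ \<in> generate ?G ?K")
  using u
proof (induction "\<Sum>i\<in>{..rr D} - {i\<^sub>0, i\<^sub>1}. nat (pairing D u (ColT i 1))" arbitrary: u t rule: less_induct)
  case less
  note u = less.prems
  show ?case
  proof (cases "\<forall>i\<le>rr D. i \<noteq> i\<^sub>0 \<and> i \<noteq> i\<^sub>1 \<longrightarrow> pairing D u (ColT i 1) < int (ell D i 1)")
    case True
    then have "root_aut D (vertical_values D Plus u) t \<in> ?K"
      using u unfolding vertical_root_group_def by (blast dest: vertical_root_Plus_iff[THEN iffD1])
    then show ?thesis by (rule generate.incl)
  next
    case False
    then obtain i where i: "i \<le> rr D" "i \<noteq> i\<^sub>0" "i \<noteq> i\<^sub>1" and large: "int (ell D i 1) \<le> pairing D u (ColT i 1)"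
      by (auto simp: not_less)
    have IH: "root_aut D (vertical_values D Plus (transfer i k u)) s \<in> generate ?G ?K"
      if k: "k = i\<^sub>0 \<or> k = i\<^sub>1" for k s
    proof (rule less.hyps)
      have k': "k \<le> rr D" using k idx by auto
      then show "vertical_root D Plus (transfer i k u)"
        by (intro vertical_root_transfer[OF D u i(1) _ large])
      have p: "pairing D (transfer i k u) (ColT j 1) =
          pairing D u (ColT j 1) - (if j = i then int (ell D i 1) else 0)"
        if "j \<in> {..rr D} - {i\<^sub>0, i\<^sub>1}" for j
        using that k AP_data_arm(1)[OF D, of j] by (auto simp: pairing_transfer[OF i(1) k'] cols_def)
      show "(\<Sum>j\<in>{..rr D} - {i\<^sub>0, i\<^sub>1}. nat (pairing D (transfer i k u) (ColT j 1))) <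
          (\<Sum>j\<in>{..rr D} - {i\<^sub>0, i\<^sub>1}. nat (pairing D u (ColT j 1)))"
      proof (rule sum_strict_mono_ex1)
        show "\<exists>j\<in>{..rr D} - {i\<^sub>0, i\<^sub>1}. nat (pairing D (transfer i k u) (ColT j 1)) < nat (pairing D u (ColT j 1))"
          using p[of i] i large AP_data_col(1)[OF D i(1) order.refl AP_data_arm(1)[OF D i(1)]]
          by (intro bexI[of _ i]) simp_all
      qed (auto simp: p simp del: One_nat_def)
    qed
    obtain a b where rel: "\<And>z. z \<in> X_hat D \<Longrightarrow>
        peval z (Tpow D i) = a * peval z (Tpow D i\<^sub>0) + b * peval z (Tpow D i\<^sub>1)"
      using trinomial_relation[OF D i(1) idx(1,2) i(2,3) idx(3)] by blast
    \<comment> \<open>The trinomial relation multiplied by t and the common cofactor.\<close>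
    have "t * vmon D u z = (t * a) * vmon D (transfer i i\<^sub>0 u) z + (t * b) * vmon D (transfer i i\<^sub>1 u) z"
      if z: "z \<in> X_hat D" for z
    proof -
      obtain m where "vmon D u z = m * peval z (Tpow D i)"
        "\<forall>k\<le>rr D. k \<noteq> i \<longrightarrow> vmon D (transfer i k u) z = m * peval z (Tpow D k)"
        using vmon_transfer[OF D u i(1) large] by blast
      then show ?thesis
        using i idx by (simp add: rel[OF z] algebra_simps)
    qed
    then have "root_aut D (vertical_values D Plus u) t =
        root_aut D (vertical_values D Plus (transfer i i\<^sub>0 u)) (t * a) \<otimes>\<^bsub>?G\<^esub>
        root_aut D (vertical_values D Plus (transfer i i\<^sub>1 u)) (t * b)"
      by (intro root_aut_eq_mult[OF D u] vertical_root_transfer[OF D u i(1) _ large] idx)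
    then show ?thesis
      using IH by (simp add: generate.eng)
  qed
qed

text \<open>Induction over the clauses of \<open>generate\<close>; the second assumption serves the
  clause for inverses of generators.\<close>

lemma generate_subset_generate:
  assumes "\<And>h. h \<in> H \<Longrightarrow> h \<in> generate G K" "\<And>h. h \<in> H \<Longrightarrow> inv\<^bsub>G\<^esub> h \<in> generate G K"
  shows "generate G H \<subseteq> generate G K"
proof
  fix x assume "x \<in> generate G H"
  then show "x \<in> generate G K"
    by induction (use assms in \<open>auto intro: generate.intros\<close>)
qed

theorem proposition10p3:
  fixes D :: "'k::{alg_closed_field, field_char_0} APdata" and i\<^sub>0 i\<^sub>1 :: nat
  assumes "AP_data D"
    and "\<not> toric (X_surface D)"
    and "\<exists>u. vertical_root D Plus u"
    and "i\<^sub>0 \<le> rr D" and "i\<^sub>1 \<le> rr D" and "i\<^sub>0 \<noteq> i\<^sub>1"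
  shows "U_group D = generate (Aut (X_surface D))
           (\<Union> {vertical_root_group D Plus u | u.
                 vertical_root D Plus u \<and>
                 (\<forall>i\<le>rr D. i \<noteq> i\<^sub>0 \<and> i \<noteq> i\<^sub>1 \<longrightarrow>
                    0 \<le> pairing D u (ColT i 1) \<and>
                    pairing D u (ColT i 1) < int (ell D i 1))})"
    (is "_ = generate ?G ?K")
proof
  let ?H = "\<Union> ({vertical_root_group D s u | s u. vertical_root D s u} \<union>
          {horizontal_root_group D s i\<^sub>0 i\<^sub>1 u | s i\<^sub>0 i\<^sub>1 u. horizontal_root D s i\<^sub>0 i\<^sub>1 u})"
  show "generate ?G ?K \<subseteq> U_group D"
    unfolding U_group_def
    by (intro generate_subset_generate) (blast intro: generate.incl generate.inv)+
  \<comment> \<open>One root at D^+ excludes all vertical roots at D^- and all horizontal roots, so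
    every generator belongs to a root at D^+.\<close>
  have root: "\<exists>u t. vertical_root D Plus u \<and> h = root_aut D (vertical_values D Plus u) t" if h: "h \<in> ?H" for h
  proof -
    obtain w where w: "vertical_root D Plus w"
      using assms(3) by blast
    have "s = Plus" if "vertical_root D s u" for s u
      using no_vertical_root_Minus[OF assms(1) w] that by (cases s) auto
    then show ?thesis
      using h no_horizontal_root[OF assms(1) w] unfolding vertical_root_group_def by blast
  qed
  \<comment> \<open>The inverse of a root automorphism belongs to the same root, with parameter -t,
    so the reduction covers both claims.\<close>
  have "h \<in> generate ?G ?K \<and> inv\<^bsub>?G\<^esub> h \<in> generate ?G ?K" if "h \<in> ?H" for h
  proof -
    obtain u t where u: "vertical_root D Plus u" and h: "h = root_aut D (vertical_values D Plus u) t"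
      using root \<open>h \<in> ?H\<close> by blast
    show ?thesis
      unfolding h inv_root_aut[OF assms(1) u]
      by (intro conjI root_aut_in_generate_reduced[OF assms(1,4-6) u])
  qed
  then show "U_group D \<subseteq> generate ?G ?K"
    unfolding U_group_def by (intro generate_subset_generate) blast+
qed

end
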